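(* Let $n\ge 5$ and $r\ge 1$ be integers, let $I_n=(x_ix_{i+1} : 1\le i\le n-1)\subseteq R_n$ be the edge ideal of the line graph (path) $L_n$ on $[n]$, and let $I_{n+r}:=\mathrm{Inc}(\mathbb{N})_{n,n+r}(I_n)\subseteq R_{n+r}$. Then $I_{n+r}$ is Cohen--Macaulay if and only if $r=n-4$.
   Context: Let $k$ be a field, $R_m=k[x_1,\dots,x_m]$ and $[m]=\{1,\dots,m\}$. For $n\le m$, $\mathrm{Inc}(\mathbb{N})_{n,m}$ is the set of strictly increasing functions $\pi:[n]\to[m]$; each such $\pi$ induces the $k$-algebra homomorphism $\pi:R_n\to R_m$, $x_i\mapsto x_{\pi(i)}$. For an ideal $I\subseteq R_n$, $\mathrm{Inc}(\mathbb{N})_{n,m}(I):=\sum_{\pi\in\mathrm{Inc}(\mathbb{N})_{n,m}}\pi(I)R_m$, the ideal of $R_m$ generated by the images of $I$ under all such $\pi$. The edge ideal of a simple graph $G$ on $[n]$ is $I(G)=(x_ix_j : \{i,j\}\in E(G))\subseteq R_n$. The line graph $L_n$ is the path on vertex set $[n]$ with edges $\{i,i+1\}$, $1\le i\le n-1$. An ideal $I\subseteq R_m$ is called Cohen--Macaulay if the (graded) quotient ring $R_m/I$ is Cohen--Macaulay, i.e. $\operatorname{depth}(R_m/I)=\dim(R_m/I)$. *)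

theory Defs
  imports
    "HOL-Algebra.QuotRing"
    "HOL-Library.Poly_Mapping"
    "HOL-Library.FuncSet"
    "HOL-Library.Extended_Nat"
begin

text \<open>Polynomials over \<open>'k\<close> in the variables \<open>x\<^sub>0, x\<^sub>1, \<dots>\<close>; a monomial is its
  finitely supported exponent vector.\<close>

type_synonym 'k mpoly = "(nat \<Rightarrow>\<^sub>0 nat) \<Rightarrow>\<^sub>0 'k"

definition mvar :: "nat \<Rightarrow> 'k::field mpoly"
  where "mvar i = Poly_Mapping.single (Poly_Mapping.single i 1) 1"

definition mconst :: "'k::field \<Rightarrow> 'k mpoly"
  where "mconst c = Poly_Mapping.single 0 c"

text \<open>\<open>poly_ring m\<close> is the ring \<open>k[x\<^sub>1, \<dots>, x\<^sub>m]\<close>, a subring of the type \<open>'k mpoly\<close>.\<close>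

definition poly_ring :: "nat \<Rightarrow> 'k::field mpoly ring"
  where "poly_ring m =
    \<lparr>carrier = {p. \<forall>t\<in>Poly_Mapping.keys p. Poly_Mapping.keys t \<subseteq> {1..m}},
     mult = (*), one = 1, zero = 0, add = (+)\<rparr>"

definition irrelevant_ideal :: "nat \<Rightarrow> 'k::field mpoly set"
  where "irrelevant_ideal m = Idl\<^bsub>poly_ring m\<^esub> (mvar ` {1..m})"

definition krull_dim :: "('a, 'b) ring_scheme \<Rightarrow> enat"
  where "krull_dim S =
    (SUP l\<in>{l. \<exists>P. (\<forall>i\<le>l. primeideal (P i) S) \<and> (\<forall>i<l. P i \<subset> P (Suc i))}. enat l)"

text \<open>\<open>fs\<close> is a regular sequence on \<open>S\<close>: each \<open>fs ! i\<close> is a nonzerodivisor modulo the ideal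
  generated by its predecessors, and \<open>S\<close> modulo the ideal generated by \<open>fs\<close> is not the zero
  ring.\<close>

definition regular_sequence :: "('a, 'b) ring_scheme \<Rightarrow> 'a list \<Rightarrow> bool"
  where "regular_sequence S fs \<longleftrightarrow>
    set fs \<subseteq> carrier S \<and>
    (\<forall>i<length fs. \<forall>a\<in>carrier S.
       fs ! i \<otimes>\<^bsub>S\<^esub> a \<in> Idl\<^bsub>S\<^esub> (set (take i fs)) \<longrightarrow> a \<in> Idl\<^bsub>S\<^esub> (set (take i fs))) \<and>
    Idl\<^bsub>S\<^esub> (set fs) \<noteq> carrier S"

definition depth :: "('a, 'b) ring_scheme \<Rightarrow> 'a set \<Rightarrow> enat"
  where "depth S J = (SUP fs\<in>{fs. regular_sequence S fs \<and> set fs \<subseteq> J}. enat (length fs))"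

text \<open>Depth of the quotient is taken with respect to its irrelevant maximal ideal, the image of
  \<open>(x\<^sub>1, \<dots>, x\<^sub>m)\<close>.\<close>

definition cohen_macaulay :: "nat \<Rightarrow> 'k::field mpoly set \<Rightarrow> bool"
  where "cohen_macaulay m I \<longleftrightarrow>
    depth (poly_ring m Quot I) ((\<lambda>f. I +>\<^bsub>poly_ring m\<^esub> f) ` irrelevant_ideal m)
      = krull_dim (poly_ring m Quot I)"

definition Inc :: "nat \<Rightarrow> nat \<Rightarrow> (nat \<Rightarrow> nat) set"
  where "Inc n m = {\<pi> \<in> {1..n} \<rightarrow>\<^sub>E {1..m}. strict_mono_on {1..n} \<pi>}"

definition induced_hom :: "(nat \<Rightarrow> nat) \<Rightarrow> 'k::field mpoly \<Rightarrow> 'k mpoly"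
  where "induced_hom \<pi> p =
    (\<Sum>t\<in>Poly_Mapping.keys p. mconst (Poly_Mapping.lookup p t) *
       (\<Prod>i\<in>Poly_Mapping.keys t. mvar (\<pi> i) ^ Poly_Mapping.lookup t i))"

definition Inc_ideal :: "nat \<Rightarrow> nat \<Rightarrow> 'k::field mpoly set \<Rightarrow> 'k mpoly set"
  where "Inc_ideal n m I = Idl\<^bsub>poly_ring m\<^esub> (\<Union>\<pi>\<in>Inc n m. induced_hom \<pi> ` I)"

text \<open>A simple graph on the vertex set \<open>{1..n}\<close> is given by its set of two-element edges.\<close>

definition edge_ideal :: "nat \<Rightarrow> nat set set \<Rightarrow> 'k::field mpoly set"
  where "edge_ideal n E = Idl\<^bsub>poly_ring n\<^esub> {mvar i * mvar j | i j. {i, j} \<in> E}"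

definition line_graph :: "nat \<Rightarrow> nat set set"
  where "line_graph n = {{i, i + 1} | i. 1 \<le> i \<and> i + 1 \<le> n}"

end

theory Submission
  imports Defs
begin

text \<open>Write \<open>m = n + r\<close> and \<open>d = r + 2\<close>. An edge \<open>{k, k + 1}\<close> of the path can be moved by a strictly
increasing map \<open>[n] \<rightarrow> [m]\<close> exactly onto the pairs \<open>i < j\<close> in \<open>[m]\<close> with \<open>j - i < d\<close> (\<open>Inc_spread\<close>,
\<open>Inc_hits_edge\<close>). Hence the ideal in question is the edge ideal of the \<open>(d - 1)\<close>-st power of the
path on \<open>[m]\<close>: a monomial ideal whose standard monomials are those supported on a set whose
distinct elements differ by at least \<open>d\<close> (\<open>Inc_ideal_line_graph\<close>). Such sets are called faces below.

The dimension of the quotient ring is at least the size of any face, and its depth is at most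
the size of any maximal face. If \<open>m \<noteq> 2 d\<close>, then there is a maximal face that is smaller than
another face (\<open>two_maximal_sizes\<close>), so depth and dimension differ. If \<open>m = 2 d\<close>, then no face has
more than two elements, \<open>{d, 2 d}\<close> is a maximal face, and the sums of the variables over the two
cliques \<open>{1..d}\<close> and \<open>{d + 1..2 d}\<close> form a regular sequence (\<open>depth_gap_ideal_ge_2\<close>), so both
invariants are \<open>2\<close>. Finally \<open>m = 2 d\<close> says \<open>r = n - 4\<close>.

The bounds on dimension and depth have a common tool, the set of values \<open>f\<^sub>1\<^sup>a (q + f\<^sub>1 g)\<close>, with \<open>q\<close> a
value of the same kind for \<open>f\<^sub>2, \<dots>, f\<^sub>l\<close> (\<open>lex_values\<close>). If \<open>l\<close> exceeds the size of every face in a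
family, a count of monomials gives a polynomial relation among \<open>f\<^sub>1, \<dots>, f\<^sub>l\<close> modulo the monomials
off these faces, and ordering the exponents lexicographically turns the relation into such a
value (\<open>lex_values_meet_off_faces\<close>). On the other hand, no such value lies in the bottom of a
chain of primes in which \<open>f\<^sub>i\<close> is picked from the \<open>i\<close>-th step (\<open>lex_values_avoid_prime_chain\<close>; this
bounds the dimension), and none annihilates an element which does not vanish locally if
\<open>f\<^sub>1, \<dots>, f\<^sub>l\<close> is a regular sequence (\<open>regular_sequence_avoids_annihilator\<close>; this bounds the depth).\<close>

section \<open>Lexicographic values in a commutative ring\<close>

text \<open>These are the values at \<open>fs\<close> of polynomials whose lexicographically least term has
coefficient \<open>1\<close>, with arbitrary coefficients in the other terms. That \<open>0\<close> is such a value for every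
\<open>fs\<close> of length \<open>l\<close> is the criterion of Coquand and Lombardi for Krull dimension less than \<open>l\<close>.\<close>
primrec lex_values :: "('a, 'b) ring_scheme \<Rightarrow> 'a list \<Rightarrow> 'a set" where
  "lex_values S [] = {\<one>\<^bsub>S\<^esub>}"
| "lex_values S (f # fs) =
    {f [^]\<^bsub>S\<^esub> a \<otimes>\<^bsub>S\<^esub> (q \<oplus>\<^bsub>S\<^esub> f \<otimes>\<^bsub>S\<^esub> g) | (a :: nat) q g. q \<in> lex_values S fs \<and> g \<in> carrier S}"

lemma (in additive_subgroup) a_diff_closed: "a \<in> H \<Longrightarrow> b \<in> H \<Longrightarrow> a \<ominus> b \<in> H"
  unfolding a_minus_def by (intro a_closed a_inv_closed)

context cring
begin

lemma lex_values_carrier: "set fs \<subseteq> carrier R \<Longrightarrow> lex_values R fs \<subseteq> carrier R"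
  by (induction fs) auto

lemma primeideal_pow:
  assumes "primeideal P R" "f \<in> carrier R" "f [^] (a::nat) \<in> P"
  shows "f \<in> P"
  using assms(3)
proof (induction a)
  case 0
  then show ?case
    using ideal.one_imp_carrier[OF primeideal.axioms(1)[OF assms(1)]]
      primeideal.I_notcarr[OF assms(1)] by simp
next
  case (Suc a)
  then show ?case using primeideal.I_prime[OF assms(1)] assms(2) by auto
qed

text \<open>In \<open>f\<^sup>a (q + f g) \<in> P 0\<close> the first factor can be cancelled because \<open>f \<notin> P 0\<close>; since \<open>f \<in> P 1\<close>,
what remains is \<open>q \<in> P 1\<close>, and the chain has become one step shorter.\<close>
lemma lex_values_avoid_prime_chain:
  assumes "set fs \<subseteq> carrier R"
    and "\<And>i. i \<le> length fs \<Longrightarrow> primeideal (P i) R"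
    and "\<And>i. i < length fs \<Longrightarrow> P i \<subseteq> P (Suc i)"
    and "\<And>i. i < length fs \<Longrightarrow> fs ! i \<in> P (Suc i) - P i"
  shows "lex_values R fs \<inter> P 0 = {}"
  using assms
proof (induction fs arbitrary: P)
  case Nil
  have "primeideal (P 0) R" using Nil(2) by simp
  then show ?case
    using ideal.one_imp_carrier[of "P 0" R] primeideal.axioms(1) primeideal.I_notcarr by fastforce
next
  case (Cons f fs)
  have IH: "lex_values R fs \<inter> P (Suc 0) = {}"
    using Cons.IH[of "\<lambda>i. P (Suc i)"] Cons.prems(1) Cons.prems(2)[of "Suc _"]
      Cons.prems(3)[of "Suc _"] Cons.prems(4)[of "Suc _"] by auto
  have P0: "primeideal (P 0) R" and P1: "ideal (P (Suc 0)) R"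
    using Cons.prems(2)[of 0] Cons.prems(2)[of "Suc 0"] primeideal.axioms(1) by auto
  have sub: "P 0 \<subseteq> P (Suc 0)" and f: "f \<in> P (Suc 0)" "f \<notin> P 0"
    using Cons.prems(3)[of 0] Cons.prems(4)[of 0] by auto
  have fc: "f \<in> carrier R" and fsc: "set fs \<subseteq> carrier R" using Cons.prems(1) by auto
  interpret P1: ideal "P (Suc 0)" R by (rule P1)
  show ?case
  proof (rule ccontr)
    assume "lex_values R (f # fs) \<inter> P 0 \<noteq> {}"
    then obtain a :: nat and q g where q: "q \<in> lex_values R fs" "g \<in> carrier R"
      and *: "f [^] a \<otimes> (q \<oplus> f \<otimes> g) \<in> P 0" by auto
    have qc: "q \<in> carrier R" using q lex_values_carrier[OF fsc] by auto
    have "f [^] a \<in> P 0 \<or> q \<oplus> f \<otimes> g \<in> P 0"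
      using primeideal.I_prime[OF P0 _ _ *] q qc fc by auto
    then have "q \<oplus> f \<otimes> g \<in> P (Suc 0)"
      using primeideal_pow[OF P0 fc] f sub by auto
    moreover have "f \<otimes> g \<in> P (Suc 0)" using f q P1.I_r_closed by auto
    ultimately have "(q \<oplus> f \<otimes> g) \<ominus> f \<otimes> g \<in> P (Suc 0)"
      using P1.a_closed P1.a_inv_closed by (simp add: a_minus_def)
    moreover have "(q \<oplus> f \<otimes> g) \<ominus> f \<otimes> g = q" using qc q fc by algebra
    ultimately show False using IH q by auto
  qed
qed

section \<open>Regular sequences and annihilators\<close>

text \<open>For a prime \<open>M\<close> this is the contraction to the ring of the extension of \<open>J\<close> to the localisation
at \<open>M\<close>. It is needed because the ring is not local: an inclusion \<open>K \<subseteq> J + f K\<close> with \<open>f \<in> M\<close> forces \<open>K\<close>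
into \<open>J\<close> only after localisation at \<open>M\<close>.\<close>
definition local_closure :: "'a set \<Rightarrow> 'a set \<Rightarrow> 'a set"
  where "local_closure M J = {v \<in> carrier R. \<exists>s\<in>carrier R - M. s \<otimes> v \<in> J}"

lemma ideal_local_closure:
  assumes M: "primeideal M R" and J: "ideal J R"
  shows "ideal (local_closure M J) R"
proof -
  interpret M: primeideal M R by fact
  interpret J: ideal J R by fact
  have 1: "\<one> \<in> carrier R - M" using M.one_imp_carrier M.I_notcarr by auto
  show ?thesis
  proof (rule idealI)
    show "ring R" by (rule ring_axioms)
    show "subgroup (local_closure M J) (add_monoid R)"
    proof (rule group.subgroupI)
      show "group (add_monoid R)" using add.group_axioms .
      show "local_closure M J \<subseteq> carrier (add_monoid R)" by (auto simp: local_closure_def)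
      have "\<zero> \<in> local_closure M J" using 1 J.zero_closed
        by (auto simp: local_closure_def intro!: bexI[of _ \<one>])
      then show "local_closure M J \<noteq> {}" by auto
    next
      fix a assume "a \<in> local_closure M J"
      then obtain s where s: "a \<in> carrier R" "s \<in> carrier R - M" "s \<otimes> a \<in> J"
        by (auto simp: local_closure_def)
      then have "\<ominus> (s \<otimes> a) \<in> J" by (intro J.a_inv_closed)
      then have "s \<otimes> (\<ominus> a) \<in> J" using s r_minus by simp
      then show "inv\<^bsub>add_monoid R\<^esub> a \<in> local_closure M J"
        using s unfolding local_closure_def a_inv_def[symmetric] by auto
    next
      fix a b assume "a \<in> local_closure M J" "b \<in> local_closure M J"
      then obtain s t where s: "a \<in> carrier R" "s \<in> carrier R - M" "s \<otimes> a \<in> J"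
        and t: "b \<in> carrier R" "t \<in> carrier R - M" "t \<otimes> b \<in> J"
        by (auto simp: local_closure_def)
      have st: "s \<otimes> t \<in> carrier R - M" using M.I_prime[of s t] s t by auto
      have "t \<otimes> (s \<otimes> a) \<oplus> s \<otimes> (t \<otimes> b) \<in> J"
        using s t J.I_l_closed J.a_closed by simp
      also have "t \<otimes> (s \<otimes> a) \<oplus> s \<otimes> (t \<otimes> b) = (s \<otimes> t) \<otimes> (a \<oplus> b)" using s(1) t(1) s(2) t(2) by (simp add: r_distr l_distr m_ac)
      finally show "a \<otimes>\<^bsub>add_monoid R\<^esub> b \<in> local_closure M J"
        using s t st unfolding local_closure_def by auto
    qed
  next
    fix a x assume "a \<in> local_closure M J" and x: "x \<in> carrier R"
    then obtain s where s: "a \<in> carrier R" "s \<in> carrier R - M" "s \<otimes> a \<in> J"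
      by (auto simp: local_closure_def)
    have "x \<otimes> (s \<otimes> a) \<in> J" using s x J.I_l_closed by simp
    also have "x \<otimes> (s \<otimes> a) = s \<otimes> (x \<otimes> a)" using s x by (simp add: m_lcomm)
    finally show "x \<otimes> a \<in> local_closure M J" using s x by (auto simp: local_closure_def)
    then show "a \<otimes> x \<in> local_closure M J" using s x by (simp add: m_comm)
  qed
qed

lemma local_closure_mono: "J \<subseteq> J' \<Longrightarrow> local_closure M J \<subseteq> local_closure M J'"
  by (auto simp: local_closure_def)

lemma local_closure_superset:
  assumes "primeideal M R" "ideal J R"
  shows "J \<subseteq> local_closure M J"
proof -
  interpret M: primeideal M R by fact
  interpret J: ideal J R by fact
  have "\<one> \<in> carrier R - M" using M.one_imp_carrier M.I_notcarr by auto
  then show ?thesis using J.Icarr by (auto simp: local_closure_def intro!: bexI[of _ \<one>])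
qed

lemma local_closure_cancel:
  assumes "primeideal M R" "ideal J R" "s \<in> carrier R - M" "v \<in> carrier R"
    "s \<otimes> v \<in> local_closure M J"
  shows "v \<in> local_closure M J"
proof -
  interpret M: primeideal M R by fact
  obtain t where t: "t \<in> carrier R - M" "t \<otimes> (s \<otimes> v) \<in> J"
    using assms(5) by (auto simp: local_closure_def)
  have "t \<otimes> s \<in> carrier R - M" using M.I_prime[of t s] assms(3) t by auto
  moreover have "(t \<otimes> s) \<otimes> v \<in> J" using t assms by (simp add: m_assoc)
  ultimately show ?thesis using assms by (auto simp: local_closure_def)
qed

lemma local_closure_nonzerodivisor:
  assumes M: "primeideal M R" and J: "ideal J R" and f: "f \<in> carrier R"
    and reg: "\<And>a. a \<in> carrier R \<Longrightarrow> f \<otimes> a \<in> J \<Longrightarrow> a \<in> J"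
    and v: "v \<in> carrier R" "f [^] (n::nat) \<otimes> v \<in> local_closure M J"
  shows "v \<in> local_closure M J"
  using v
proof (induction n arbitrary: v)
  case 0
  then show ?case by simp
next
  case (Suc n)
  have "f [^] n \<otimes> (f \<otimes> v) \<in> local_closure M J" using Suc.prems f by (simp add: m_assoc)
  then have "f \<otimes> v \<in> local_closure M J" using Suc f by simp
  then obtain s where s: "s \<in> carrier R - M" "s \<otimes> (f \<otimes> v) \<in> J" by (auto simp: local_closure_def)
  have "s \<otimes> (f \<otimes> v) = f \<otimes> (s \<otimes> v)" using s f Suc.prems by (simp add: m_lcomm)
  then have "s \<otimes> v \<in> J" using reg s f Suc.prems by auto
  then show ?case using s Suc.prems by (auto simp: local_closure_def)
qed

lemma ideal_colon:
  assumes J: "ideal J R" and K: "K \<subseteq> carrier R"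
  shows "ideal {g \<in> carrier R. \<forall>v\<in>K. g \<otimes> v \<in> J} R"
proof -
  interpret J: ideal J R by fact
  have K': "v \<in> K \<Longrightarrow> v \<in> carrier R" for v using K by auto
  show ?thesis
  proof (rule idealI)
    show "ring R" by (rule ring_axioms)
    show "subgroup {g \<in> carrier R. \<forall>v\<in>K. g \<otimes> v \<in> J} (add_monoid R)"
    proof (rule group.subgroupI)
      show "group (add_monoid R)" using add.group_axioms .
      have "\<zero> \<in> {g \<in> carrier R. \<forall>v\<in>K. g \<otimes> v \<in> J}" using K' J.zero_closed by auto
      then show "{g \<in> carrier R. \<forall>v\<in>K. g \<otimes> v \<in> J} \<noteq> {}" by blast
    next
      fix a assume "a \<in> {g \<in> carrier R. \<forall>v\<in>K. g \<otimes> v \<in> J}"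
      then show "inv\<^bsub>add_monoid R\<^esub> a \<in> {g \<in> carrier R. \<forall>v\<in>K. g \<otimes> v \<in> J}"
        using K' J.a_inv_closed unfolding a_inv_def[symmetric] by (auto simp: l_minus)
    qed (use K' J.a_closed in \<open>auto simp: l_distr\<close>)
  next
    fix a x assume a: "a \<in> {g \<in> carrier R. \<forall>v\<in>K. g \<otimes> v \<in> J}" and x: "x \<in> carrier R"
    then show "x \<otimes> a \<in> {g \<in> carrier R. \<forall>v\<in>K. g \<otimes> v \<in> J}"
      using K' J.I_l_closed by (auto simp: m_assoc)
    then show "a \<otimes> x \<in> {g \<in> carrier R. \<forall>v\<in>K. g \<otimes> v \<in> J}"
      using a x by (simp add: m_comm)
  qed
qed


text \<open>Nakayama's lemma for a set \<open>K\<close> with \<open>K \<subseteq> L + f K\<close> locally, where \<open>L\<close> is the closure of \<open>J\<close>.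
Starting from \<open>v\<^sub>0\<close> choose \<open>v\<^sub>n\<close> with \<open>s\<^sub>n v\<^sub>n \<equiv> f v\<^sub>n\<^sub>+\<^sub>1\<close>, so that \<open>f\<^sup>n v\<^sub>n \<equiv> \<sigma>\<^sub>n v\<^sub>0\<close> modulo \<open>L\<close> with \<open>\<sigma>\<^sub>n \<notin> M\<close>. Some
\<open>v\<^sub>n\<close> is a combination of its predecessors, which makes \<open>f\<^sup>n v\<^sub>n\<close> also congruent to a multiple of \<open>f v\<^sub>0\<close>.
Comparison gives an element outside \<open>M\<close> which moves \<open>v\<^sub>0\<close> into \<open>L\<close>. The hypothesis on sequences is a
form of the Noetherian property.\<close>
lemma local_Nakayama:
  assumes M: "primeideal M R" and J: "ideal J R" and f: "f \<in> M" and K: "K \<subseteq> carrier R"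
    and noeth: "\<And>v :: nat \<Rightarrow> 'a. (\<And>n. v n \<in> carrier R) \<Longrightarrow> \<exists>n. v n \<in> Idl (v ` {..<n})"
    and step: "\<And>v. v \<in> K \<Longrightarrow> \<exists>s\<in>carrier R - M. \<exists>w\<in>K. s \<otimes> v \<ominus> f \<otimes> w \<in> local_closure M J"
    and v0: "v0 \<in> K"
  shows "v0 \<in> local_closure M J"
proof -
  define L where "L = local_closure M J"
  interpret M: primeideal M R by fact
  interpret L: ideal L R unfolding L_def by (rule ideal_local_closure[OF M J])
  obtain S W where SW: "\<And>v. v \<in> K \<Longrightarrow> S v \<in> carrier R - M \<and> W v \<in> K \<and> S v \<otimes> v \<ominus> f \<otimes> W v \<in> L"
    using step unfolding L_def by metis
  define v where "v = (\<lambda>n. (W ^^ n) v0)"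
  have vK: "v n \<in> K" for n by (induction n) (auto simp: v_def v0 SW)
  have vc: "v n \<in> carrier R" for n using vK K by auto
  define s where "s = (\<lambda>n. S (v n))"
  have s: "s n \<in> carrier R" "s n \<notin> M" "s n \<otimes> v n \<ominus> f \<otimes> v (Suc n) \<in> L" for n
    using SW[OF vK[of n]] by (auto simp: s_def v_def)
  define \<sigma> where "\<sigma> = rec_nat \<one> (\<lambda>k x. x \<otimes> s k)"
  have \<sigma>0: "\<sigma> 0 = \<one>" and \<sigma>S: "\<sigma> (Suc n) = \<sigma> n \<otimes> s n" for n by (auto simp: \<sigma>_def)
  have \<sigma>c: "\<sigma> n \<in> carrier R" for n by (induction n) (auto simp: \<sigma>0 \<sigma>S s)
  have \<sigma>M: "\<sigma> n \<notin> M" for n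
  proof (induction n)
    case 0 then show ?case using M.one_imp_carrier M.I_notcarr by (auto simp: \<sigma>0)
  next
    case (Suc n) then show ?case using M.I_prime[of "\<sigma> n" "s n"] s \<sigma>c by (auto simp: \<sigma>S)
  qed
  have v0c: "v0 \<in> carrier R" using v0 K by auto
  have fc: "f \<in> carrier R" using f M.Icarr by auto
  have pc: "f [^] (k::nat) \<in> carrier R" for k using fc by simp
  have cong: "f [^] n \<otimes> v n \<ominus> \<sigma> n \<otimes> v0 \<in> L" for n
  proof (induction n)
    case 0 then show ?case using v0c L.zero_closed by (simp add: \<sigma>0 v_def a_minus_def r_neg)
  next
    case (Suc n)
    have "s n \<otimes> (f [^] n \<otimes> v n \<ominus> \<sigma> n \<otimes> v0) \<ominus> f [^] n \<otimes> (s n \<otimes> v n \<ominus> f \<otimes> v (Suc n)) \<in> L"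
      by (intro L.a_diff_closed L.I_l_closed Suc s pc)
    also have "s n \<otimes> (f [^] n \<otimes> v n \<ominus> \<sigma> n \<otimes> v0) \<ominus> f [^] n \<otimes> (s n \<otimes> v n \<ominus> f \<otimes> v (Suc n))
       = (f [^] n \<otimes> f) \<otimes> v (Suc n) \<ominus> (\<sigma> n \<otimes> s n) \<otimes> v0"
      using s(1)[of n] pc[of n] fc vc[of n] vc[of "Suc n"] \<sigma>c[of n] v0c by algebra
    finally show ?case by (simp add: \<sigma>S)
  qed
  obtain n where n: "v n \<in> Idl (v ` {..<n})" using noeth[of v] vc by auto
  \<comment> \<open>The elements whose \<open>f\<^sup>n\<close>-multiple is congruent to a multiple of \<open>f v\<^sub>0\<close>; being an ideal, they
  contain all combinations of \<open>v\<^sub>0, \<dots>, v\<^sub>n\<^sub>-\<^sub>1\<close>.\<close>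
  define T where "T = {w \<in> carrier R. \<exists>c\<in>carrier R. f [^] n \<otimes> w \<ominus> (f \<otimes> c) \<otimes> v0 \<in> L}"
  have T: "ideal T R"
  proof (rule idealI)
    show "ring R" by (rule ring_axioms)
    show "subgroup T (add_monoid R)"
    proof (rule group.subgroupI)
      show "group (add_monoid R)" using add.group_axioms .
      show "T \<subseteq> carrier (add_monoid R)" by (auto simp: T_def)
      have "\<zero> \<in> T" unfolding T_def using pc[of n] v0c fc L.zero_closed
        by (auto intro!: bexI[of _ \<zero>] simp: a_minus_def)
      then show "T \<noteq> {}" by blast
    next
      fix a assume "a \<in> T"
      then obtain c where c: "a \<in> carrier R" "c \<in> carrier R" "f [^] n \<otimes> a \<ominus> (f \<otimes> c) \<otimes> v0 \<in> L"
        by (auto simp: T_def)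
      have "\<ominus> (f [^] n \<otimes> a \<ominus> (f \<otimes> c) \<otimes> v0) \<in> L" by (intro L.a_inv_closed c)
      also have "\<ominus> (f [^] n \<otimes> a \<ominus> (f \<otimes> c) \<otimes> v0) = f [^] n \<otimes> (\<ominus> a) \<ominus> (f \<otimes> (\<ominus> c)) \<otimes> v0"
        using c(1,2) pc[of n] fc v0c by algebra
      finally show "inv\<^bsub>add_monoid R\<^esub> a \<in> T" unfolding a_inv_def[symmetric] T_def using c by blast
    next
      fix a b assume "a \<in> T" "b \<in> T"
      then obtain c e where c: "a \<in> carrier R" "c \<in> carrier R" "f [^] n \<otimes> a \<ominus> (f \<otimes> c) \<otimes> v0 \<in> L"
        and e: "b \<in> carrier R" "e \<in> carrier R" "f [^] n \<otimes> b \<ominus> (f \<otimes> e) \<otimes> v0 \<in> L"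
        by (auto simp: T_def)
      have "(f [^] n \<otimes> a \<ominus> (f \<otimes> c) \<otimes> v0) \<oplus> (f [^] n \<otimes> b \<ominus> (f \<otimes> e) \<otimes> v0) \<in> L"
        by (intro L.a_closed c e)
      also have "(f [^] n \<otimes> a \<ominus> (f \<otimes> c) \<otimes> v0) \<oplus> (f [^] n \<otimes> b \<ominus> (f \<otimes> e) \<otimes> v0)
         = f [^] n \<otimes> (a \<oplus> b) \<ominus> (f \<otimes> (c \<oplus> e)) \<otimes> v0"
        using c(1,2) e(1,2) pc[of n] fc v0c by algebra
      finally show "a \<otimes>\<^bsub>add_monoid R\<^esub> b \<in> T" unfolding T_def using c e by auto
    qed
  next
    fix a x assume "a \<in> T" and x: "x \<in> carrier R"
    then obtain c where c: "a \<in> carrier R" "c \<in> carrier R" "f [^] n \<otimes> a \<ominus> (f \<otimes> c) \<otimes> v0 \<in> L"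
      by (auto simp: T_def)
    have "x \<otimes> (f [^] n \<otimes> a \<ominus> (f \<otimes> c) \<otimes> v0) \<in> L" by (intro L.I_l_closed c x)
    also have "x \<otimes> (f [^] n \<otimes> a \<ominus> (f \<otimes> c) \<otimes> v0) = f [^] n \<otimes> (x \<otimes> a) \<ominus> (f \<otimes> (x \<otimes> c)) \<otimes> v0"
      using c(1,2) x pc[of n] fc v0c by algebra
    finally show "x \<otimes> a \<in> T" unfolding T_def using c x by blast
    then show "a \<otimes> x \<in> T" using c x by (simp add: m_comm)
  qed
  have "v k \<in> T" if k: "k < n" for k
  proof -
    define j where "j = n - Suc k"
    have nj: "f [^] n = f [^] j \<otimes> f \<otimes> f [^] k"
    proof -
      have "n = Suc j + k" using k by (simp add: j_def)
      then have "f [^] n = f [^] (Suc j) \<otimes> f [^] k" unfolding nat_pow_mult[OF fc] by (rule arg_cong)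
      then show ?thesis by simp
    qed
    have "(f \<otimes> f [^] j) \<otimes> (f [^] k \<otimes> v k \<ominus> \<sigma> k \<otimes> v0) \<in> L"
      using cong fc pc by (intro L.I_l_closed) auto
    also have "(f \<otimes> f [^] j) \<otimes> (f [^] k \<otimes> v k \<ominus> \<sigma> k \<otimes> v0)
       = (f [^] j \<otimes> f \<otimes> f [^] k) \<otimes> v k \<ominus> (f \<otimes> (f [^] j \<otimes> \<sigma> k)) \<otimes> v0"
      using fc pc[of j] pc[of k] vc[of k] \<sigma>c[of k] v0c by algebra
    finally show ?thesis unfolding T_def nj[symmetric] using vc pc \<sigma>c by blast
  qed
  then have "v ` {..<n} \<subseteq> T" by auto
  then have "v n \<in> T" using n genideal_minimal[OF T] by auto
  then obtain c where c: "c \<in> carrier R" "f [^] n \<otimes> v n \<ominus> (f \<otimes> c) \<otimes> v0 \<in> L" by (auto simp: T_def)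
  have "(f [^] n \<otimes> v n \<ominus> (f \<otimes> c) \<otimes> v0) \<ominus> (f [^] n \<otimes> v n \<ominus> \<sigma> n \<otimes> v0) \<in> L"
    by (intro L.a_diff_closed c cong)
  also have "(f [^] n \<otimes> v n \<ominus> (f \<otimes> c) \<otimes> v0) \<ominus> (f [^] n \<otimes> v n \<ominus> \<sigma> n \<otimes> v0) = (\<sigma> n \<ominus> f \<otimes> c) \<otimes> v0"
    using fc c(1) pc[of n] vc[of n] v0c \<sigma>c[of n] by algebra
  finally have *: "(\<sigma> n \<ominus> f \<otimes> c) \<otimes> v0 \<in> local_closure M J" by (simp add: L_def)
  have "\<sigma> n \<ominus> f \<otimes> c \<notin> M"
  proof
    assume "\<sigma> n \<ominus> f \<otimes> c \<in> M"
    then have "(\<sigma> n \<ominus> f \<otimes> c) \<oplus> f \<otimes> c \<in> M" using M.I_r_closed[OF f c(1)] by (rule M.a_closed)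
    moreover have "(\<sigma> n \<ominus> f \<otimes> c) \<oplus> f \<otimes> c = \<sigma> n" using \<sigma>c[of n] fc c(1) by algebra
    ultimately show False using \<sigma>M by simp
  qed
  then have "\<sigma> n \<ominus> f \<otimes> c \<in> carrier R - M" using \<sigma>c fc c by auto
  from local_closure_cancel[OF M J this v0c *] show ?thesis .
qed

lemma mem_genideal_insert:
  assumes J: "ideal J R" and f: "f \<in> carrier R"
  shows "x \<in> Idl (insert f J) \<longleftrightarrow> (\<exists>j\<in>J. \<exists>w\<in>carrier R. x = j \<oplus> f \<otimes> w)"
proof -
  interpret J: ideal J R by fact
  have eq: "J <+>\<^bsub>R\<^esub> PIdl f = Idl (J \<union> PIdl f)"
    by (rule union_genideal[OF J cgenideal_ideal[OF f], symmetric])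
  have "Idl (J \<union> PIdl f) = Idl (insert f J)"
  proof
    have i: "ideal (Idl (insert f J)) R" using f J.a_subset by (intro genideal_ideal) auto
    have s: "insert f J \<subseteq> Idl (insert f J)" using f J.a_subset by (intro genideal_self) auto
    have "PIdl f \<subseteq> Idl (insert f J)" using cgenideal_minimal[OF i] s by auto
    then show "Idl (J \<union> PIdl f) \<subseteq> Idl (insert f J)"
      using s by (intro genideal_minimal[OF i]) auto
    have c: "J \<union> PIdl f \<subseteq> carrier R"
      using J.a_subset additive_subgroup.a_subset[OF ideal.axioms(1)[OF cgenideal_ideal[OF f]]] by auto
    show "Idl (insert f J) \<subseteq> Idl (J \<union> PIdl f)"
      using genideal_self[OF c] cgenideal_self[OF f] by (intro genideal_minimal genideal_ideal c) auto
  qed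
  then have "Idl (insert f J) = J <+>\<^bsub>R\<^esub> PIdl f" using eq by simp
  moreover have "PIdl f = {f \<otimes> w | w. w \<in> carrier R}"
    unfolding cgenideal_def by (intro Collect_cong ex_cong1) (auto simp: m_comm f)
  ultimately show ?thesis by (auto simp: set_add_def')
qed

text \<open>This is the inequality between the depth and the dimension of an associated prime, with the
prime replaced by the annihilator \<open>A\<close> of an element \<open>v\<close> that is nonzero locally. Let \<open>K\<close> be the set of
all elements killed by \<open>A\<close>, and \<open>A'\<close> the annihilator of \<open>K\<close>, everything modulo the local closure of \<open>J\<close>.
If \<open>f\<^sup>a (q + f g) \<in> A'\<close>, regularity cancels \<open>f\<^sup>a\<close>, so that \<open>q\<close> lies in \<open>A'' = A' + (f)\<close>. By \<open>local_Nakayama\<close>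
the set \<open>K\<close> does not vanish locally modulo \<open>J' = J + (f)\<close>; hence \<open>A''\<close> annihilates an element that is
locally nonzero modulo \<open>J'\<close>, and the induction continues with \<open>J'\<close>, \<open>A''\<close>, \<open>q\<close>.\<close>
lemma regular_sequence_avoids_annihilator:
  assumes M: "primeideal M R"
    and noeth: "\<And>v :: nat \<Rightarrow> 'a. (\<And>n. v n \<in> carrier R) \<Longrightarrow> \<exists>n. v n \<in> Idl (v ` {..<n})"
    and "set fs \<subseteq> M" "ideal J R"
    and "\<And>i a. i < length fs \<Longrightarrow> a \<in> carrier R \<Longrightarrow> fs ! i \<otimes> a \<in> Idl (J \<union> set (take i fs)) \<Longrightarrow>
        a \<in> Idl (J \<union> set (take i fs))"
    and "A \<subseteq> carrier R" "v \<in> carrier R" "v \<notin> local_closure M J" "\<And>g. g \<in> A \<Longrightarrow> g \<otimes> v \<in> local_closure M J"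
  shows "lex_values R fs \<inter> A = {}"
  using assms(3-)
proof (induction fs arbitrary: J A v)
  case Nil
  then show ?case using Nil(7)[of \<one>] by auto
next
  case (Cons f fs)
  interpret M: primeideal M R by fact
  interpret J: ideal J R by fact
  define L where "L = local_closure M J"
  interpret L: ideal L R unfolding L_def by (rule ideal_local_closure[OF M \<open>ideal J R\<close>])
  have fM: "f \<in> M" and fsM: "set fs \<subseteq> M" using Cons.prems(1) by auto
  have fc: "f \<in> carrier R" and fsc: "set fs \<subseteq> carrier R" using fM fsM M.Icarr by auto
  have IdlJ: "Idl J = J" using genideal_minimal[OF Cons.prems(2)] genideal_self[OF J.a_subset] by auto
  have reg0: "a \<in> carrier R \<Longrightarrow> f \<otimes> a \<in> J \<Longrightarrow> a \<in> J" for a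
    using Cons.prems(3)[of 0 a] IdlJ by simp
  define K where "K = {v \<in> carrier R. \<forall>g\<in>A. g \<otimes> v \<in> L}"
  define A' where "A' = {g \<in> carrier R. \<forall>v\<in>K. g \<otimes> v \<in> L}"
  have Kc: "K \<subseteq> carrier R" by (auto simp: K_def)
  have AA': "A \<subseteq> A'" using Cons.prems(4) by (auto simp: A'_def K_def)
  interpret A': ideal A' R unfolding A'_def by (rule ideal_colon[OF L.is_ideal Kc])
  define J' where "J' = Idl (insert f J)"
  have J'c: "insert f J \<subseteq> carrier R" using fc J.a_subset by auto
  have J': "ideal J' R" unfolding J'_def by (rule genideal_ideal[OF J'c])
  have JJ': "insert f J \<subseteq> J'" unfolding J'_def by (rule genideal_self[OF J'c])
  define L' where "L' = local_closure M J'"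
  interpret L': ideal L' R unfolding L'_def by (rule ideal_local_closure[OF M J'])
  have LL': "L \<subseteq> L'" unfolding L_def L'_def using JJ' by (intro local_closure_mono) auto
  have fL': "f \<in> L'" unfolding L'_def using local_closure_superset[OF M J'] JJ' by auto
  \<comment> \<open>Otherwise \<open>s u = j + f w\<close> for \<open>u \<in> K\<close>; as \<open>f\<close> is regular modulo \<open>J\<close>, also \<open>w\<close> is killed by \<open>A\<close>, and
  Nakayama's lemma applies to \<open>K\<close>.\<close>
  have "\<not> K \<subseteq> L'"
  proof
    assume KL: "K \<subseteq> L'"
    have "\<exists>s\<in>carrier R - M. \<exists>w\<in>K. s \<otimes> u \<ominus> f \<otimes> w \<in> L" if u: "u \<in> K" for u
    proof -
      have uc: "u \<in> carrier R" using u Kc by auto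
      have "u \<in> local_closure M J'" using KL u unfolding L'_def by blast
      then obtain s where s: "s \<in> carrier R - M" "s \<otimes> u \<in> J'"
        unfolding local_closure_def by blast
      have sc: "s \<in> carrier R" using s by auto
      obtain j w where jw: "j \<in> J" "w \<in> carrier R" "s \<otimes> u = j \<oplus> f \<otimes> w"
        using s(2) unfolding J'_def mem_genideal_insert[OF Cons.prems(2) fc] by blast
      have jc: "j \<in> carrier R" using jw J.Icarr by auto
      have jL: "j \<in> L" using jw local_closure_superset[OF M Cons.prems(2)] by (auto simp: L_def)
      have "s \<otimes> u \<ominus> f \<otimes> w = j" unfolding jw(3) using jc jw(2) fc by algebra
      moreover have "w \<in> K"
      proof -
        have "g \<otimes> w \<in> L" if g: "g \<in> A" for g
        proof -
          have gc: "g \<in> carrier R" using g Cons.prems(4) by auto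
          have "g \<otimes> u \<in> L" using u g by (auto simp: K_def)
          then have "s \<otimes> (g \<otimes> u) \<ominus> g \<otimes> j \<in> L"
            by (intro L.a_diff_closed L.I_l_closed[OF _ sc] L.I_l_closed[OF jL gc])
          also have "s \<otimes> (g \<otimes> u) \<ominus> g \<otimes> j = g \<otimes> (s \<otimes> u) \<ominus> g \<otimes> j"
            using sc gc uc jc by algebra
          also have "\<dots> = f \<otimes> (g \<otimes> w)" unfolding jw(3) using gc fc jw(2) jc by algebra
          finally have "f [^] (1::nat) \<otimes> (g \<otimes> w) \<in> local_closure M J" using fc by (simp add: L_def)
          then show ?thesis unfolding L_def
            using local_closure_nonzerodivisor[OF M Cons.prems(2) fc reg0, of "g \<otimes> w" 1] gc jw(2) by simp
        qed
        then show ?thesis using jw by (auto simp: K_def)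
      qed
      ultimately show ?thesis using s(1) jL by metis
    qed
    then have "u \<in> L" if "u \<in> K" for u
      using local_Nakayama[OF M Cons.prems(2) fM Kc noeth _ that] unfolding L_def by blast
    moreover have "v \<in> K" using Cons.prems(5,7) by (auto simp: K_def L_def)
    ultimately show False using Cons.prems(6) by (auto simp: L_def)
  qed
  then obtain v' where v': "v' \<in> K" "v' \<notin> L'" by blast
  define A'' where "A'' = Idl (insert f A')"
  have A''c: "A'' \<subseteq> carrier R"
    unfolding A''_def using fc A'.a_subset
    by (intro additive_subgroup.a_subset[OF ideal.axioms(1)[OF genideal_ideal]]) auto
  have ann: "g \<otimes> v' \<in> L'" if g: "g \<in> A''" for g
  proof -
    have vc: "v' \<in> carrier R" using v' Kc by auto
    obtain b w where bw: "b \<in> A'" "w \<in> carrier R" "g = b \<oplus> f \<otimes> w"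
      using g unfolding A''_def mem_genideal_insert[OF A'.is_ideal fc] by blast
    have bc: "b \<in> carrier R" using bw A'.Icarr by auto
    have "b \<otimes> v' \<in> L'" using bw(1) v'(1) LL' unfolding A'_def by blast
    moreover have "f \<otimes> (w \<otimes> v') \<in> L'" using fL' bw vc by (intro L'.I_r_closed) auto
    ultimately have "b \<otimes> v' \<oplus> f \<otimes> (w \<otimes> v') \<in> L'" by (rule L'.a_closed)
    also have "b \<otimes> v' \<oplus> f \<otimes> (w \<otimes> v') = g \<otimes> v'" unfolding bw(3) using bc fc bw(2) vc by algebra
    finally show ?thesis .
  qed
  have gen: "Idl (J' \<union> set (take i fs)) = Idl (J \<union> set (take (Suc i) (f # fs)))" for i
  proof -
    have c: "set (take i fs) \<subseteq> carrier R" using fsc set_take_subset[of i fs] by blast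
    have c1: "J \<union> set (take (Suc i) (f # fs)) \<subseteq> carrier R" using c fc J.a_subset by auto
    have c2: "J' \<union> set (take i fs) \<subseteq> carrier R"
      using c additive_subgroup.a_subset[OF ideal.axioms(1)[OF J']] by auto
    show ?thesis
    proof
      have "J' \<subseteq> Idl (J \<union> set (take (Suc i) (f # fs)))"
        unfolding J'_def using genideal_self[OF c1] by (intro genideal_minimal genideal_ideal c1) auto
      then show "Idl (J' \<union> set (take i fs)) \<subseteq> Idl (J \<union> set (take (Suc i) (f # fs)))"
        using genideal_self[OF c1] by (intro genideal_minimal genideal_ideal c1) auto
      show "Idl (J \<union> set (take (Suc i) (f # fs))) \<subseteq> Idl (J' \<union> set (take i fs))"
        using genideal_self[OF c2] JJ' by (intro genideal_minimal genideal_ideal c2) auto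
    qed
  qed
  have IH: "lex_values R fs \<inter> A'' = {}"
  proof (rule Cons.IH[OF fsM J' _ A''c])
    show "v' \<in> carrier R" using v' Kc by auto
    show "v' \<notin> local_closure M J'" using v' by (simp add: L'_def)
    show "g \<otimes> v' \<in> local_closure M J'" if "g \<in> A''" for g using ann[OF that] by (simp add: L'_def)
    show "a \<in> Idl (J' \<union> set (take i fs))"
      if "i < length fs" "a \<in> carrier R" "fs ! i \<otimes> a \<in> Idl (J' \<union> set (take i fs))" for i a
      using Cons.prems(3)[of "Suc i" a] that unfolding gen by simp
  qed
  show ?case
  proof (rule ccontr)
    assume "lex_values R (f # fs) \<inter> A \<noteq> {}"
    then obtain n :: nat and q g where q: "q \<in> lex_values R fs" "g \<in> carrier R"
      and *: "f [^] n \<otimes> (q \<oplus> f \<otimes> g) \<in> A'" using AA' by auto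
    have qc: "q \<in> carrier R" using q lex_values_carrier[OF fsc] by auto
    have hc: "q \<oplus> f \<otimes> g \<in> carrier R" using qc q fc by auto
    have "(q \<oplus> f \<otimes> g) \<otimes> u \<in> L" if u: "u \<in> K" for u
    proof -
      have uc: "u \<in> carrier R" using u Kc by auto
      have "(f [^] n \<otimes> (q \<oplus> f \<otimes> g)) \<otimes> u \<in> L" using * u unfolding A'_def by blast
      then have "f [^] n \<otimes> ((q \<oplus> f \<otimes> g) \<otimes> u) \<in> local_closure M J"
        unfolding L_def using m_assoc[OF nat_pow_closed[OF fc] hc uc] by metis
      then have "f [^] n \<otimes> ((q \<oplus> f \<otimes> g) \<otimes> u) \<in> local_closure M J" by assumption
      from local_closure_nonzerodivisor[OF M Cons.prems(2) fc _ m_closed[OF hc uc] this] reg0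
      show ?thesis unfolding L_def by blast
    qed
    then have hA: "q \<oplus> f \<otimes> g \<in> A'" using hc unfolding A'_def by blast
    have gc: "\<ominus> g \<in> carrier R" using q(2) by (rule a_inv_closed)
    have eq: "q = (q \<oplus> f \<otimes> g) \<oplus> f \<otimes> (\<ominus> g)" using qc fc q(2) by algebra
    have "q \<in> A''" unfolding A''_def mem_genideal_insert[OF A'.is_ideal fc]
      using hA gc eq by metis
    then show False using IH q(1) by blast
  qed
qed

end

section \<open>The polynomial ring and its monomial ideals\<close>

abbreviation monomial :: "(nat \<Rightarrow>\<^sub>0 nat) \<Rightarrow> 'k::field mpoly"
  where "monomial t \<equiv> Poly_Mapping.single t 1"

lemma keys_add_nat: "Poly_Mapping.keys (s + t) = Poly_Mapping.keys s \<union> Poly_Mapping.keys (t :: nat \<Rightarrow>\<^sub>0 nat)"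
  by (auto simp: in_keys_iff lookup_add)

lemma poly_ring_sel:
  "mult (poly_ring m) = (*)" "one (poly_ring m) = 1" "zero (poly_ring m) = 0" "add (poly_ring m) = (+)"
  by (simp_all add: poly_ring_def)

lemma mem_poly_ring: "p \<in> carrier (poly_ring m) \<longleftrightarrow> (\<forall>t\<in>Poly_Mapping.keys p. Poly_Mapping.keys t \<subseteq> {1..m})"
  by (simp add: poly_ring_def)

lemma keys_mult_cases:
  assumes "t \<in> Poly_Mapping.keys (p * q)"
  obtains u v where "u \<in> Poly_Mapping.keys p" "v \<in> Poly_Mapping.keys q" "t = u + v"
  using assms keys_mult[of p q] by blast

lemma keys_add_cases:
  assumes "t \<in> Poly_Mapping.keys (p + q)"
  shows "t \<in> Poly_Mapping.keys p \<or> t \<in> Poly_Mapping.keys q"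
  using assms keys_add[of p q] by blast

lemma keys_uminus [simp]: "Poly_Mapping.keys (- p) = Poly_Mapping.keys (p :: 'a \<Rightarrow>\<^sub>0 'b::ab_group_add)"
  by (auto simp: in_keys_iff)

lemma poly_ring_cring: "cring (poly_ring m :: 'k::field mpoly ring)"
proof (rule cringI)
  show "abelian_group (poly_ring m :: 'k mpoly ring)"
  proof (rule abelian_groupI)
    fix x assume "x \<in> carrier (poly_ring m :: 'k mpoly ring)"
    then show "\<exists>y\<in>carrier (poly_ring m). y \<oplus>\<^bsub>poly_ring m\<^esub> x = \<zero>\<^bsub>poly_ring m\<^esub>"
      by (intro bexI[of _ "- x"]) (auto simp: poly_ring_sel mem_poly_ring)
  qed (auto simp: poly_ring_sel mem_poly_ring add_ac dest!: keys_add_cases)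
  show "comm_monoid (poly_ring m :: 'k mpoly ring)"
  proof (rule comm_monoidI)
    fix x y assume "x \<in> carrier (poly_ring m :: 'k mpoly ring)" "y \<in> carrier (poly_ring m :: 'k mpoly ring)"
    then show "x \<otimes>\<^bsub>poly_ring m\<^esub> y \<in> carrier (poly_ring m)"
      unfolding poly_ring_sel mem_poly_ring by (blast elim!: keys_mult_cases dest: keys_add_nat[THEN equalityD1, THEN subsetD])
  qed (auto simp: poly_ring_sel mem_poly_ring mult_ac)
qed (auto simp: poly_ring_sel distrib_right)

interpretation poly_ring: cring "poly_ring m" for m
  by (rule poly_ring_cring)

lemma poly_ring_uminus:
  assumes "p \<in> carrier (poly_ring m)"
  shows "\<ominus>\<^bsub>poly_ring m\<^esub> p = - p"
proof -
  have "- p \<in> carrier (poly_ring m)" using assms by (auto simp: mem_poly_ring)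
  then show ?thesis
    using assms by (intro poly_ring.minus_equality) (simp_all add: poly_ring_sel)
qed

lemma poly_ring_pow: "p [^]\<^bsub>poly_ring m\<^esub> (n::nat) = p ^ n"
  by (induction n) (simp_all add: poly_ring_sel mult.commute)

lemma poly_ring_sum: "(\<And>x. x \<in> A \<Longrightarrow> f x \<in> carrier (poly_ring m)) \<Longrightarrow> sum f A \<in> carrier (poly_ring m)"
proof (induction A rule: infinite_finite_induct)
  case (insert x A)
  then show ?case using poly_ring.a_closed[of "f x" m "sum f A"] by (simp add: poly_ring_sel)
qed (use poly_ring.zero_closed[of m] in \<open>simp_all add: poly_ring_sel\<close>)

lemma mult_mem_poly_ring: "p \<in> carrier (poly_ring m) \<Longrightarrow> q \<in> carrier (poly_ring m) \<Longrightarrow> p * q \<in> carrier (poly_ring m)"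
  using poly_ring.m_closed[of p m q] by (simp add: poly_ring_sel)

lemma add_mem_poly_ring: "p \<in> carrier (poly_ring m) \<Longrightarrow> q \<in> carrier (poly_ring m) \<Longrightarrow> p + q \<in> carrier (poly_ring m)"
  using poly_ring.a_closed[of p m q] by (simp add: poly_ring_sel)

lemma diff_mem_poly_ring: "p \<in> carrier (poly_ring m) \<Longrightarrow> q \<in> carrier (poly_ring m) \<Longrightarrow> p - q \<in> carrier (poly_ring m)"
  using poly_ring.minus_closed[of p m q] by (simp add: poly_ring_sel a_minus_def poly_ring_uminus)

lemma power_mem_poly_ring: "p \<in> carrier (poly_ring m) \<Longrightarrow> p ^ n \<in> carrier (poly_ring m)"
  using poly_ring.nat_pow_closed[of p m n] by (simp add: poly_ring_pow)

lemma one_mem_poly_ring: "1 \<in> carrier (poly_ring m)"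
  and zero_mem_poly_ring: "0 \<in> carrier (poly_ring m)"
  using poly_ring.one_closed[of m] poly_ring.zero_closed[of m] by (simp_all add: poly_ring_sel)

lemma single_mem_poly_ring: "Poly_Mapping.keys t \<subseteq> {1..m} \<Longrightarrow> Poly_Mapping.single t c \<in> carrier (poly_ring m)"
  by (simp add: mem_poly_ring)

lemma mconst_mem_poly_ring: "mconst c \<in> carrier (poly_ring m)"
  by (simp add: mconst_def single_mem_poly_ring)

lemma mvar_mem_poly_ring: "i \<in> {1..m} \<Longrightarrow> mvar i \<in> carrier (poly_ring m)"
  by (simp add: mvar_def single_mem_poly_ring)

lemmas poly_ring_closed = mult_mem_poly_ring add_mem_poly_ring diff_mem_poly_ring power_mem_poly_ring
  one_mem_poly_ring zero_mem_poly_ring single_mem_poly_ring mconst_mem_poly_ring mvar_mem_poly_ring poly_ring_sum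

lemma poly_ring_idealI:
  fixes J :: "'k::field mpoly set"
  assumes "J \<subseteq> carrier (poly_ring m)" "0 \<in> J"
    and "\<And>p q. p \<in> J \<Longrightarrow> q \<in> J \<Longrightarrow> p + q \<in> J"
    and "\<And>p q. p \<in> J \<Longrightarrow> q \<in> carrier (poly_ring m) \<Longrightarrow> q * p \<in> J"
  shows "ideal J (poly_ring m)"
proof (rule idealI)
  show "ring (poly_ring m :: 'k mpoly ring)" by (rule poly_ring.ring_axioms)
  show "subgroup J (add_monoid (poly_ring m))"
  proof (rule group.subgroupI)
    show "group (add_monoid (poly_ring m :: 'k mpoly ring))" by (rule poly_ring.add.group_axioms)
    fix a assume a: "a \<in> J"
    then have "(- 1) * a \<in> J" using assms(4)[of a "- 1"] by (simp add: mem_poly_ring)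
    then show "inv\<^bsub>add_monoid (poly_ring m)\<^esub> a \<in> J"
      using a assms(1) unfolding a_inv_def[symmetric] by (auto simp: poly_ring_uminus)
  qed (use assms in \<open>auto simp: poly_ring_sel\<close>)
qed (use assms in \<open>auto simp: poly_ring_sel mult.commute\<close>)

lemma
  assumes "ideal J (poly_ring m)"
  shows poly_ideal_add: "p \<in> J \<Longrightarrow> q \<in> J \<Longrightarrow> p + q \<in> J"
    and poly_ideal_mult: "p \<in> J \<Longrightarrow> q \<in> carrier (poly_ring m) \<Longrightarrow> q * p \<in> J"
    and poly_ideal_zero: "0 \<in> J"
    and poly_ideal_carrier: "p \<in> J \<Longrightarrow> p \<in> carrier (poly_ring m)"
    and poly_ideal_diff: "p \<in> J \<Longrightarrow> q \<in> J \<Longrightarrow> p - q \<in> J"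
proof -
  interpret J: ideal J "poly_ring m" by fact
  show "p \<in> J \<Longrightarrow> q \<in> J \<Longrightarrow> p + q \<in> J" using J.a_closed[of p q] by (simp add: poly_ring_sel)
  show "p \<in> J \<Longrightarrow> q \<in> carrier (poly_ring m) \<Longrightarrow> q * p \<in> J"
    using J.I_l_closed[of p q] by (simp add: poly_ring_sel)
  show "0 \<in> J" using J.zero_closed by (simp add: poly_ring_sel)
  show *: "p \<in> J \<Longrightarrow> p \<in> carrier (poly_ring m)" for p by (rule J.Icarr)
  show "p \<in> J \<Longrightarrow> q \<in> J \<Longrightarrow> p - q \<in> J"
    using J.a_diff_closed[of p q] *[of q] by (simp add: poly_ring_sel a_minus_def poly_ring_uminus)
qed

lemma poly_ideal_sum:
  assumes "ideal J (poly_ring m)"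
  shows "(\<And>x. x \<in> A \<Longrightarrow> f x \<in> J) \<Longrightarrow> sum f A \<in> J"
  by (induction A rule: infinite_finite_induct)
    (simp_all add: poly_ideal_zero[OF assms] poly_ideal_add[OF assms])

lemma sum_single_keys:
  assumes "finite A" "Poly_Mapping.keys p \<subseteq> A"
  shows "(\<Sum>t\<in>A. Poly_Mapping.single t (Poly_Mapping.lookup p t)) = p"
  by (rule poly_mapping_eqI)
    (use assms in \<open>auto simp: lookup_sum lookup_single when_def in_keys_iff subset_iff sum.delta'\<close>)

lemma poly_ideal_memI:
  assumes J: "ideal J (poly_ring m)"
    and "\<And>t. t \<in> Poly_Mapping.keys p \<Longrightarrow> monomial t \<in> J"
  shows "p \<in> J"
proof -
  have "Poly_Mapping.single t (Poly_Mapping.lookup p t) \<in> J" if "t \<in> Poly_Mapping.keys p" for t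
    using poly_ideal_mult[OF J assms(2)[OF that] mconst_mem_poly_ring]
    by (simp add: mconst_def mult_single)
  then have "(\<Sum>t\<in>Poly_Mapping.keys p. Poly_Mapping.single t (Poly_Mapping.lookup p t)) \<in> J"
    by (intro poly_ideal_sum[OF J])
  then show ?thesis by (simp add: sum_single_keys)
qed

definition monomial_ideal :: "nat \<Rightarrow> ((nat \<Rightarrow>\<^sub>0 nat) \<Rightarrow> bool) \<Rightarrow> 'k::field mpoly set"
  where "monomial_ideal m Q = {p \<in> carrier (poly_ring m). \<forall>t\<in>Poly_Mapping.keys p. Q t}"

lemma ideal_monomial_ideal:
  assumes "\<And>s t. Q t \<Longrightarrow> Q (s + t)"
  shows "ideal (monomial_ideal m Q) (poly_ring m)"
proof (rule poly_ring_idealI)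
  fix p q :: "'a mpoly" assume p: "p \<in> monomial_ideal m Q"
  show "p + q \<in> monomial_ideal m Q" if q: "q \<in> monomial_ideal m Q"
    using p q poly_ring_closed(2)[of p m q] by (auto simp: monomial_ideal_def dest!: keys_add_cases)
  show "q * p \<in> monomial_ideal m Q" if q: "q \<in> carrier (poly_ring m)"
    using p q poly_ring_closed(1)[of q m p] assms by (auto simp: monomial_ideal_def elim!: keys_mult_cases)
qed (auto simp: monomial_ideal_def poly_ring_closed)

text \<open>The ideal generated by the variables \<open>x\<^sub>i\<close> with \<open>i \<in> {1..m} - F\<close>.\<close>
definition off_face_ideal :: "nat \<Rightarrow> nat set \<Rightarrow> 'k::field mpoly set"
  where "off_face_ideal m F = monomial_ideal m (\<lambda>t. \<not> Poly_Mapping.keys t \<subseteq> F)"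

lemma ideal_off_face: "ideal (off_face_ideal m F) (poly_ring m)"
  unfolding off_face_ideal_def by (rule ideal_monomial_ideal) (auto simp: keys_add_nat)

text \<open>Modulo this ideal every polynomial is congruent to its part supported on \<open>F\<close>. The product of
two such parts is again supported on \<open>F\<close>, so it can lie in the ideal only if it is zero, and the
polynomials form an integral domain.\<close>
lemma primeideal_off_face: "primeideal (off_face_ideal m F :: 'k::field mpoly set) (poly_ring m)"
proof (rule primeidealI[OF ideal_off_face poly_ring_cring])
  have "1 \<notin> off_face_ideal m F" by (simp add: off_face_ideal_def monomial_ideal_def)
  then show "carrier (poly_ring m) \<noteq> (off_face_ideal m F :: 'k mpoly set)"
    using one_mem_poly_ring by metis
next
  note J = ideal_off_face[of m F]
  fix p q :: "'k mpoly"
  assume pc: "p \<in> carrier (poly_ring m)" and qc: "q \<in> carrier (poly_ring m)"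
    and pq: "p \<otimes>\<^bsub>poly_ring m\<^esub> q \<in> off_face_ideal m F"
  define restr :: "'k mpoly \<Rightarrow> 'k mpoly" where "restr r = (\<Sum>t\<in>{t \<in> Poly_Mapping.keys r. Poly_Mapping.keys t \<subseteq> F}.
      Poly_Mapping.single t (Poly_Mapping.lookup r t))" for r
  have lr: "Poly_Mapping.lookup (restr r) t = (if Poly_Mapping.keys t \<subseteq> F then Poly_Mapping.lookup r t else 0)" for r t
    unfolding restr_def
    by (auto simp: lookup_sum lookup_single when_def in_keys_iff sum.delta')
  have kr: "Poly_Mapping.keys (restr r) \<subseteq> Poly_Mapping.keys r" "t \<in> Poly_Mapping.keys (restr r) \<Longrightarrow> Poly_Mapping.keys t \<subseteq> F" for r t
    by (auto simp: in_keys_iff lr split: if_splits)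
  have rc: "restr r \<in> carrier (poly_ring m)" if "r \<in> carrier (poly_ring m)" for r
    using that kr(1)[of r] by (auto simp: mem_poly_ring)
  have diff: "r - restr r \<in> off_face_ideal m F" if "r \<in> carrier (poly_ring m)" for r
    using that poly_ring_closed(3)[OF that rc[OF that]]
    by (auto simp: off_face_ideal_def monomial_ideal_def in_keys_iff lookup_minus lr)
  have zero: "r \<in> off_face_ideal m F" if "r \<in> carrier (poly_ring m)" "restr r = 0" for r
    using diff[OF that(1)] that(2) by simp
  have "restr p * restr q = p * q - (q * (p - restr p) + restr p * (q - restr q))"
    by (simp add: algebra_simps)
  also have "\<dots> \<in> off_face_ideal m F"
    using pq unfolding poly_ring_sel
    by (rule poly_ideal_diff[OF J _ poly_ideal_add[OF J poly_ideal_mult[OF J diff[OF pc] qc]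
          poly_ideal_mult[OF J diff[OF qc] rc[OF pc]]]])
  finally have "restr p * restr q \<in> off_face_ideal m F" .
  moreover have "Poly_Mapping.keys t \<subseteq> F" if "t \<in> Poly_Mapping.keys (restr p * restr q)" for t
    using that by (rule keys_mult_cases) (use kr(2) in \<open>simp add: keys_add_nat\<close>)
  ultimately have "Poly_Mapping.keys (restr p * restr q) = {}"
    by (auto simp: off_face_ideal_def monomial_ideal_def)
  then have "restr p * restr q = 0" by simp
  then have "restr p = 0 \<or> restr q = 0" by simp
  then show "p \<in> off_face_ideal m F \<or> q \<in> off_face_ideal m F" using zero pc qc by auto
qed


section \<open>Algebraic relations by counting monomials\<close>

lemma linear_relation:
  fixes a :: "'e \<Rightarrow> 't \<Rightarrow> 'k::field"
  assumes "finite T" "finite E" "card T < card E"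
  shows "\<exists>c. (\<exists>e\<in>E. c e \<noteq> 0) \<and> (\<forall>t\<in>T. (\<Sum>e\<in>E. c e * a e t) = 0)"
  using assms
proof (induction T arbitrary: E a rule: finite_induct)
  case empty
  then have "E \<noteq> {}" by auto
  then show ?case by (intro exI[of _ "\<lambda>_. 1"]) auto
next
  case (insert t T)
  show ?case
  proof (cases "\<forall>e\<in>E. a e t = 0")
    case True
    have "card T < card E" using insert by simp
    then obtain c where "\<exists>e\<in>E. c e \<noteq> 0" "\<forall>t\<in>T. (\<Sum>e\<in>E. c e * a e t) = 0"
      using insert.IH[OF insert.prems(1), of a] by blast
    then show ?thesis using True by (intro exI[of _ c]) auto
  next
    case False
    then obtain e0 where e0: "e0 \<in> E" "a e0 t \<noteq> 0" by auto
    define b where "b e s = a e s - a e t / a e0 t * a e0 s" for e s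
    have "card T < card (E - {e0})" using insert e0 by simp
    then obtain c where c: "\<exists>e\<in>E - {e0}. c e \<noteq> 0" "\<forall>s\<in>T. (\<Sum>e\<in>E - {e0}. c e * b e s) = 0"
      using insert.IH[of "E - {e0}" b] insert.prems(1) by blast
    define c' where "c' = c(e0 := - (\<Sum>e\<in>E - {e0}. c e * (a e t / a e0 t)))"
    have "(\<Sum>e\<in>E. c' e * a e s) = (\<Sum>e\<in>E - {e0}. c e * b e s)" for s
    proof -
      have "(\<Sum>e\<in>E. c' e * a e s) = c' e0 * a e0 s + (\<Sum>e\<in>E - {e0}. c' e * a e s)"
        using e0 insert.prems(1) by (simp add: sum.remove)
      also have "(\<Sum>e\<in>E - {e0}. c' e * a e s) = (\<Sum>e\<in>E - {e0}. c e * a e s)"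
        by (rule sum.cong) (auto simp: c'_def)
      finally show ?thesis
        by (simp add: b_def c'_def sum_distrib_right right_diff_distrib sum_subtractf mult.assoc)
    qed
    moreover have "b e t = 0" for e using e0 by (simp add: b_def)
    ultimately have "\<forall>s\<in>insert t T. (\<Sum>e\<in>E. c' e * a e s) = 0" using c(2) by simp
    moreover have "\<exists>e\<in>E. c' e \<noteq> 0" using c(1) by (auto simp: c'_def)
    ultimately show ?thesis by blast
  qed
qed

text \<open>The exponents are lists so that the head can be split off together with the head of \<open>gs\<close>. For
lists of different lengths the surplus is ignored.\<close>
fun power_product :: "'a::comm_monoid_mult list \<Rightarrow> nat list \<Rightarrow> 'a" where
  "power_product (g # gs) (e # es) = g ^ e * power_product gs es"
| "power_product _ _ = 1"

lemma power_product_mem_poly_ring: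
  "set gs \<subseteq> carrier (poly_ring m) \<Longrightarrow> power_product gs e \<in> carrier (poly_ring m)"
  by (induction gs e rule: power_product.induct) (auto intro!: poly_ring_closed)

lemma lookup_mconst_mult: "Poly_Mapping.lookup (mconst a * p) t = a * Poly_Mapping.lookup p t"
proof -
  have "Poly_Mapping.lookup (Poly_Mapping.map ((*) a) p) t = a * Poly_Mapping.lookup p t"
    by (simp add: Poly_Mapping.map.rep_eq when_def)
  then show ?thesis unfolding mconst_def mult_map_scale_conv_mult .
qed

text \<open>Let \<open>a\<close> be the least exponent of the first element that occurs with a nonzero coefficient.
After extracting \<open>g\<^sup>a\<close>, the terms with exponent exactly \<open>a\<close> form a nonzero polynomial in the
remaining elements, to which induction applies, and all others are multiples of \<open>g\<close>. The scalar \<open>b\<close>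
normalises the lexicographically least coefficient to \<open>1\<close>.\<close>
lemma scaled_polynomial_value_in_lex_values:
  fixes gs :: "'k::field mpoly list"
  assumes "set gs \<subseteq> carrier (poly_ring m)" "finite E" "\<And>e. e \<in> E \<Longrightarrow> length e = length gs"
    "\<exists>e\<in>E. c e \<noteq> 0"
  shows "\<exists>b. b \<noteq> 0 \<and> mconst b * (\<Sum>e\<in>E. mconst (c e) * power_product gs e) \<in> lex_values (poly_ring m) gs"
  using assms
proof (induction gs arbitrary: E c)
  case Nil
  then have "E = {[]}" by auto
  then show ?case using Nil
    by (intro exI[of _ "inverse (c [])"]) (auto simp: mult_single poly_ring_sel mconst_def)
next
  case (Cons g gs)
  define E' where "E' = {e \<in> E. c e \<noteq> 0}"
  have E': "finite E'" "E' \<noteq> {}" using Cons.prems by (auto simp: E'_def)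
  have len: "\<exists>x xs. e = x # xs \<and> length xs = length gs" if "e \<in> E'" for e
    using Cons.prems(3)[of e] that by (cases e) (auto simp: E'_def)
  define a where "a = Min (hd ` E')"
  have amin: "a \<le> hd e" if "e \<in> E'" for e using that E' by (auto simp: a_def)
  have "a \<in> hd ` E'" unfolding a_def using E' by (intro Min_in) auto
  define E0 where "E0 = {e \<in> E'. hd e = a}"
  define E1 where "E1 = {e \<in> E'. hd e \<noteq> a}"
  have E0: "E0 \<noteq> {}" using \<open>a \<in> hd ` E'\<close> by (auto simp: E0_def)
  have inj: "inj_on tl E0"
  proof (rule inj_onI)
    fix x y assume "x \<in> E0" "y \<in> E0" "tl x = tl y"
    then show "x = y" using len[of x] len[of y] by (auto simp: E0_def)
  qed
  have eE0: "e = a # tl e" if "e \<in> E0" for e 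
  proof -
    obtain x xs where "e = x # xs" using len[of e] \<open>e \<in> E0\<close> by (auto simp: E0_def)
    then show ?thesis using \<open>e \<in> E0\<close> by (simp add: E0_def)
  qed
  define c0 where "c0 e = c (a # e)" for e
  have "\<exists>b. b \<noteq> 0 \<and> mconst b * (\<Sum>e\<in>tl ` E0. mconst (c0 e) * power_product gs e) \<in> lex_values (poly_ring m) gs"
  proof (rule Cons.IH)
    show "set gs \<subseteq> carrier (poly_ring m)" using Cons.prems by auto
    show "finite (tl ` E0)" using E' by (auto simp: E0_def)
    show "length e = length gs" if "e \<in> tl ` E0" for e using that len by (force simp: E0_def)
    obtain e where e: "e \<in> E0" using E0 by auto
    then have "c (a # tl e) \<noteq> 0" unfolding eE0[OF e, symmetric] by (simp add: E0_def E'_def)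
    then have "c0 (tl e) \<noteq> 0" by (simp add: c0_def)
    then show "\<exists>e\<in>tl ` E0. c0 e \<noteq> 0" using e by auto
  qed
  then obtain b where b: "b \<noteq> 0"
    "mconst b * (\<Sum>e\<in>tl ` E0. mconst (c0 e) * power_product gs e) \<in> lex_values (poly_ring m) gs" by blast
  define q where "q = (\<Sum>e\<in>tl ` E0. mconst (c0 e) * power_product gs e)"
  define h where "h = (\<Sum>e\<in>E1. mconst (c e) * (g ^ (hd e - Suc a) * power_product gs (tl e)))"
  have gc: "g \<in> carrier (poly_ring m)" "set gs \<subseteq> carrier (poly_ring m)" using Cons.prems by auto
  have hc: "mconst b * h \<in> carrier (poly_ring m)"
    unfolding h_def by (intro poly_ring_closed gc power_product_mem_poly_ring)
  have "(\<Sum>e\<in>E. mconst (c e) * power_product (g # gs) e) = (\<Sum>e\<in>E'. mconst (c e) * power_product (g # gs) e)"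
    by (rule sum.mono_neutral_right) (use Cons.prems in \<open>auto simp: E'_def mconst_def\<close>)
  also have "\<dots> = (\<Sum>e\<in>E0. mconst (c e) * power_product (g # gs) e) + (\<Sum>e\<in>E1. mconst (c e) * power_product (g # gs) e)"
    using E' by (subst sum.union_disjoint[symmetric]) (auto simp: E0_def E1_def intro!: sum.cong)
  also have "(\<Sum>e\<in>E0. mconst (c e) * power_product (g # gs) e) = g ^ a * q"
  proof -
    have "q = (\<Sum>e\<in>E0. mconst (c e) * power_product gs (tl e))"
      unfolding q_def sum.reindex[OF inj] by (rule sum.cong) (auto simp: c0_def eE0[symmetric])
    moreover have "power_product (g # gs) e = g ^ a * power_product gs (tl e)" if "e \<in> E0" for e
      by (subst eE0[OF that]) simp
    ultimately show ?thesis by (simp add: sum_distrib_left mult.left_commute)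
  qed
  also have "(\<Sum>e\<in>E1. mconst (c e) * power_product (g # gs) e) = g ^ a * (g * h)"
  proof -
    have "power_product (g # gs) e = g ^ a * (g * (g ^ (hd e - Suc a) * power_product gs (tl e)))" if e: "e \<in> E1" for e
    proof -
      obtain x xs where x: "e = x # xs" using len[of e] e by (auto simp: E1_def)
      have "Suc a \<le> x" using amin[of e] e x by (auto simp: E1_def)
      then have "g ^ x = g ^ (Suc a + (x - Suc a))" by simp
      also have "\<dots> = g ^ a * (g * g ^ (x - Suc a))" by (simp only: power_add power_Suc2 mult.assoc)
      finally show ?thesis by (simp add: x mult.assoc)
    qed
    then show ?thesis by (simp add: h_def sum_distrib_left mult.left_commute)
  qed
  finally have *: "mconst b * (\<Sum>e\<in>E. mconst (c e) * power_product (g # gs) e)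
      = g ^ a * (mconst b * q + g * (mconst b * h))" by (simp add: algebra_simps)
  have "g ^ a * (mconst b * q + g * (mconst b * h)) \<in> lex_values (poly_ring m) (g # gs)"
    using b(2) hc by (auto simp: poly_ring_sel poly_ring_pow q_def)
  then show ?case unfolding *[symmetric] using b(1) by blast
qed

text \<open>Summation over the fixed set \<open>{1..m}\<close>, rather than over the support of \<open>t\<close>, makes the degree
additive on the nose.\<close>
definition total_degree :: "nat \<Rightarrow> (nat \<Rightarrow>\<^sub>0 nat) \<Rightarrow> nat"
  where "total_degree m t = (\<Sum>i\<in>{1..m}. Poly_Mapping.lookup t i)"

lemma total_degree_add: "total_degree m (s + t) = total_degree m s + total_degree m t"
  by (simp add: total_degree_def lookup_add sum.distrib)

lemma total_degree_power:
  assumes "\<And>t. t \<in> Poly_Mapping.keys g \<Longrightarrow> total_degree m t \<le> D"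
    and "t \<in> Poly_Mapping.keys (g ^ n)"
  shows "total_degree m t \<le> n * D"
  using assms(2)
proof (induction n arbitrary: t)
  case 0 then show ?case by (simp add: total_degree_def)
next
  case (Suc n)
  then obtain u v where uv: "u \<in> Poly_Mapping.keys g" "v \<in> Poly_Mapping.keys (g ^ n)" "t = u + v"
    by (auto elim!: keys_mult_cases)
  then show ?case using Suc.IH[OF uv(2)] assms(1)[OF uv(1)] by (simp add: total_degree_add)
qed

lemma total_degree_power_product:
  assumes "\<And>g t. g \<in> set gs \<Longrightarrow> t \<in> Poly_Mapping.keys g \<Longrightarrow> total_degree m t \<le> D"
    and "t \<in> Poly_Mapping.keys (power_product gs e)"
  shows "total_degree m t \<le> sum_list e * D"
  using assms
proof (induction gs e arbitrary: t rule: power_product.induct)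
  case (1 g gs e es)
  then obtain u v where uv: "u \<in> Poly_Mapping.keys (g ^ e)" "v \<in> Poly_Mapping.keys (power_product gs es)" "t = u + v"
    by (auto elim!: keys_mult_cases)
  have "total_degree m v \<le> sum_list es * D" using 1 uv(2) by auto
  moreover have "total_degree m u \<le> e * D" using total_degree_power[OF _ uv(1)] 1(2) by auto
  ultimately show ?case using uv(3) by (simp add: total_degree_add algebra_simps)
qed (auto simp: total_degree_def)

lemma card_bounded_monomials:
  assumes "finite F"
  shows "finite {t :: nat \<Rightarrow>\<^sub>0 nat. Poly_Mapping.keys t \<subseteq> F \<and> (\<forall>i\<in>F. Poly_Mapping.lookup t i \<le> B)}" (is "finite ?T")
    and "card {t :: nat \<Rightarrow>\<^sub>0 nat. Poly_Mapping.keys t \<subseteq> F \<and> (\<forall>i\<in>F. Poly_Mapping.lookup t i \<le> B)} \<le> (B + 1) ^ card F"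
proof -
  define h where "h t = restrict (Poly_Mapping.lookup t) F" for t :: "nat \<Rightarrow>\<^sub>0 nat"
  have inj: "inj_on h ?T"
  proof (rule inj_onI)
    fix s t assume s: "s \<in> ?T" and t: "t \<in> ?T" and eq: "h s = h t"
    show "s = t"
    proof (rule poly_mapping_eqI)
      fix i show "Poly_Mapping.lookup s i = Poly_Mapping.lookup t i"
      proof (cases "i \<in> F")
        case True
        then show ?thesis using fun_cong[OF eq, of i] by (simp add: h_def)
      next
        case False
        then have "i \<notin> Poly_Mapping.keys s" "i \<notin> Poly_Mapping.keys t" using s t by auto
        then show ?thesis by (simp only: in_keys_iff) simp
      qed
    qed
  qed
  have sub: "h ` ?T \<subseteq> F \<rightarrow>\<^sub>E {..B}" by (auto simp: h_def)
  have fin: "finite (F \<rightarrow>\<^sub>E {..B})" using assms by (intro finite_PiE) auto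
  show "finite ?T" using inj sub fin by (meson finite_imageD finite_subset)
  have "card ?T \<le> card (F \<rightarrow>\<^sub>E {..B})" using card_inj_on_le[OF inj sub fin] .
  also have "\<dots> = (B + 1) ^ card F" using assms by (simp add: card_PiE)
  finally show "card ?T \<le> (B + 1) ^ card F" .
qed

text \<open>The power products of \<open>l\<close> polynomials with exponents at most \<open>N\<close> number \<open>(N + 1)\<^sup>l\<close>, whereas their
degrees grow linearly in \<open>N\<close>, so that only \<open>O(N\<^sup>k)\<close> monomials on the faces can occur in them. As
\<open>k < l\<close>, some nontrivial linear combination of the power products has no monomial on any of the
faces.\<close>
lemma lex_values_meet_off_faces:
  fixes gs :: "'k::field mpoly list"
  assumes gs: "set gs \<subseteq> carrier (poly_ring m)"
    and FF: "finite FF" "\<And>F. F \<in> FF \<Longrightarrow> F \<subseteq> {1..m} \<and> card F \<le> k"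
    and len: "k < length gs"
  shows "\<exists>w\<in>lex_values (poly_ring m) gs. \<forall>F\<in>FF. w \<in> off_face_ideal m F"
proof -
  define l where "l = length gs"
  have "finite (\<Union>g\<in>set gs. total_degree m ` Poly_Mapping.keys g)" by simp
  then obtain D where D0: "\<forall>x\<in>(\<Union>g\<in>set gs. total_degree m ` Poly_Mapping.keys g). x \<le> D"
    by (meson finite_nat_set_iff_bounded_le)
  then have D: "\<And>g t. g \<in> set gs \<Longrightarrow> t \<in> Poly_Mapping.keys g \<Longrightarrow> total_degree m t \<le> D" by auto
  \<comment> \<open>Chosen such that \<open>card FF * (l * N * D + 1)\<^sup>k \<le> N * (N + 1)\<^sup>k < (N + 1)\<^sup>l\<close>.\<close>
  define N where "N = card FF * (D * l + 1) ^ k"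
  define B where "B = l * N * D"
  define T where "T F = {t :: nat \<Rightarrow>\<^sub>0 nat. Poly_Mapping.keys t \<subseteq> F \<and> (\<forall>i\<in>F. Poly_Mapping.lookup t i \<le> B)}" for F
  have finF: "finite F" if "F \<in> FF" for F using FF(2)[OF that] finite_subset by blast
  define E where "E = {e. set e \<subseteq> {..N} \<and> length e = l}"
  have finE: "finite E" unfolding E_def by (rule finite_lists_length_eq) simp
  have cardE: "card E = (N + 1) ^ l" unfolding E_def by (subst card_lists_length_eq) auto
  have fT: "finite (\<Union>F\<in>FF. T F)" unfolding T_def using card_bounded_monomials(1) finF FF(1) by blast
  have "card (\<Union>F\<in>FF. T F) \<le> (\<Sum>F\<in>FF. card (T F))" by (rule card_UN_le[OF FF(1)])
  also have "\<dots> \<le> (\<Sum>F\<in>FF. (B + 1) ^ k)"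
  proof (rule sum_mono)
    fix F assume F: "F \<in> FF"
    have "card (T F) \<le> (B + 1) ^ card F" unfolding T_def by (rule card_bounded_monomials(2)[OF finF[OF F]])
    also have "\<dots> \<le> (B + 1) ^ k" using FF(2)[OF F] by (intro power_increasing) auto
    finally show "card (T F) \<le> (B + 1) ^ k" .
  qed
  also have "\<dots> = card FF * (B + 1) ^ k" by simp
  also have "\<dots> \<le> card FF * ((D * l + 1) * (N + 1)) ^ k"
    by (intro mult_left_mono power_mono) (auto simp: B_def algebra_simps)
  also have "\<dots> = N * (N + 1) ^ k" by (simp only: N_def power_mult_distrib mult.assoc)
  also have "\<dots> < (N + 1) ^ Suc k" by simp
  also have "\<dots> \<le> (N + 1) ^ l" using len by (intro power_increasing) (auto simp: l_def)
  finally have "card (\<Union>F\<in>FF. T F) < card E" using cardE by simp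
  from linear_relation[OF fT finE this, of "\<lambda>e. Poly_Mapping.lookup (power_product gs e)"]
  obtain c where c: "\<exists>e\<in>E. c e \<noteq> 0"
    "\<And>t. t \<in> (\<Union>F\<in>FF. T F) \<Longrightarrow> (\<Sum>e\<in>E. c e * Poly_Mapping.lookup (power_product gs e) t) = 0" by blast
  define w where "w = (\<Sum>e\<in>E. mconst (c e) * power_product gs e)"
  have lw: "Poly_Mapping.lookup w t = (\<Sum>e\<in>E. c e * Poly_Mapping.lookup (power_product gs e) t)" for t
    by (simp add: w_def lookup_sum lookup_mconst_mult)
  have deg: "total_degree m t \<le> B" if t: "t \<in> Poly_Mapping.keys w" for t
  proof -
    have "\<exists>e\<in>E. t \<in> Poly_Mapping.keys (power_product gs e)"
    proof (rule ccontr)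
      assume "\<not> (\<exists>e\<in>E. t \<in> Poly_Mapping.keys (power_product gs e))"
      then have "Poly_Mapping.lookup w t = 0" unfolding lw in_keys_iff by (intro sum.neutral) simp
      then show False using t by (simp add: in_keys_iff)
    qed
    then obtain e where e: "e \<in> E" "t \<in> Poly_Mapping.keys (power_product gs e)" by blast
    have le: "set e \<subseteq> {..N}" "length e = l" using e(1) by (auto simp: E_def)
    have "sum_list e = (\<Sum>x\<leftarrow>e. x)" by simp
    also have "\<dots> \<le> (\<Sum>x\<leftarrow>e. N)" using le(1) by (intro sum_list_mono) auto
    also have "\<dots> = l * N" using le(2) by (simp add: sum_list_triv)
    finally have "sum_list e \<le> l * N" .
    then show ?thesis using total_degree_power_product[OF D e(2)] unfolding B_def
      by (meson le_trans mult_le_mono1)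
  qed
  have wc: "w \<in> carrier (poly_ring m)"
    unfolding w_def by (intro poly_ring_closed power_product_mem_poly_ring gs)
  have w: "w \<in> off_face_ideal m F" if F: "F \<in> FF" for F
  proof -
    have "\<not> Poly_Mapping.keys t \<subseteq> F" if t: "t \<in> Poly_Mapping.keys w" for t
    proof
      assume s: "Poly_Mapping.keys t \<subseteq> F"
      have "Poly_Mapping.lookup t i \<le> B" if i: "i \<in> F" for i
      proof -
        have "Poly_Mapping.lookup t i \<le> total_degree m t"
          unfolding total_degree_def using i FF(2)[OF F] by (intro member_le_sum) auto
        then show ?thesis using deg[OF t] by simp
      qed
      then have "t \<in> (\<Union>F\<in>FF. T F)" using s F by (auto simp: T_def)
      then show False using c(2) t by (simp add: in_keys_iff lw)
    qed
    then show ?thesis using wc by (auto simp: off_face_ideal_def monomial_ideal_def)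
  qed
  obtain b where b: "b \<noteq> 0" "mconst b * w \<in> lex_values (poly_ring m) gs"
    using scaled_polynomial_value_in_lex_values[OF gs finE _ c(1)] unfolding w_def E_def l_def by blast
  moreover have "mconst b * w \<in> off_face_ideal m F" if "F \<in> FF" for F
    by (rule poly_ideal_mult[OF ideal_off_face w[OF that] mconst_mem_poly_ring])
  ultimately show ?thesis by blast
qed

section \<open>Passing to a quotient ring\<close>

context cring
begin

lemma quot_eq_iff:
  assumes "ideal I R" "a \<in> carrier R" "b \<in> carrier R"
  shows "I +> a = I +> b \<longleftrightarrow> a \<ominus> b \<in> I"
  using quotient_eq_iff_same_a_r_cos[OF assms] by auto

lemma quot_mem_image_iff:
  assumes I: "ideal I R" and J: "ideal J R" and IJ: "I \<subseteq> J" and a: "a \<in> carrier R"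
  shows "I +> a \<in> (+>) I ` J \<longleftrightarrow> a \<in> J"
proof
  interpret J: ideal J R by fact
  assume "I +> a \<in> (+>) I ` J"
  then obtain b where b: "b \<in> J" "I +> a = I +> b" by auto
  have bc: "b \<in> carrier R" using b J.Icarr by auto
  have "a \<ominus> b \<in> J" using quot_eq_iff[OF I a bc] b IJ by auto
  then have "(a \<ominus> b) \<oplus> b \<in> J" using b J.a_closed by auto
  moreover have "(a \<ominus> b) \<oplus> b = a" using a bc by algebra
  ultimately show "a \<in> J" by simp
qed auto

lemma carrier_quot: "carrier (R Quot I) = (+>) I ` carrier R"
  by (auto simp: FactRing_def A_RCOSETS_def')

lemma zero_quot: "\<zero>\<^bsub>R Quot I\<^esub> = I"
  by (simp add: FactRing_def)

lemma quot_Idl_iff: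
  assumes I: "ideal I R" and X: "X \<subseteq> carrier R" and a: "a \<in> carrier R"
  shows "I +> a \<in> Idl\<^bsub>R Quot I\<^esub> ((+>) I ` X) \<longleftrightarrow> a \<in> Idl (I \<union> X)"
proof -
  interpret I: ideal I R by fact
  interpret S: ring "R Quot I" by (rule I.quotient_is_ring)
  interpret h: ring_hom_ring R "R Quot I" "(+>) I" by (rule I.rcos_ring_hom_ring)
  have c: "I \<union> X \<subseteq> carrier R" using X I.a_subset by auto
  have cS: "(+>) I ` X \<subseteq> carrier (R Quot I)" using X by (auto simp: carrier_quot)
  note id = genideal_ideal[OF c] and idS = S.genideal_ideal[OF cS]
  have s: "I \<union> X \<subseteq> Idl (I \<union> X)" by (rule genideal_self[OF c])
  show ?thesis
  proof
    assume *: "I +> a \<in> Idl\<^bsub>R Quot I\<^esub> ((+>) I ` X)"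
    have "Idl\<^bsub>R Quot I\<^esub> ((+>) I ` X) \<subseteq> (+>) I ` (Idl (I \<union> X))"
      using s by (intro S.genideal_minimal ring_ideal_imp_quot_ideal I id image_mono) auto
    then show "a \<in> Idl (I \<union> X)" using * quot_mem_image_iff[OF I id _ a] s by auto
  next
    assume *: "a \<in> Idl (I \<union> X)"
    have "Idl (I \<union> X) \<subseteq> {r \<in> carrier R. I +> r \<in> Idl\<^bsub>R Quot I\<^esub> ((+>) I ` X)}"
    proof (rule genideal_minimal[OF h.ideal_vimage[OF idS]])
      have "I +> r = \<zero>\<^bsub>R Quot I\<^esub>" if "r \<in> I" for r
        unfolding zero_quot by (rule I.a_rcos_const[OF that])
      then have "I +> r \<in> Idl\<^bsub>R Quot I\<^esub> ((+>) I ` X)" if "r \<in> I" for r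
        using that additive_subgroup.zero_closed[OF ideal.axioms(1)[OF idS]] by simp
      moreover have "I +> r \<in> Idl\<^bsub>R Quot I\<^esub> ((+>) I ` X)" if "r \<in> X" for r
        using S.genideal_self[OF cS] that by blast
      ultimately show "I \<union> X \<subseteq> {r \<in> carrier R. I +> r \<in> Idl\<^bsub>R Quot I\<^esub> ((+>) I ` X)}"
        using c by blast
    qed
    then show "I +> a \<in> Idl\<^bsub>R Quot I\<^esub> ((+>) I ` X)" using * by auto
  qed
qed

lemma quot_mult: "ideal I R \<Longrightarrow> a \<in> carrier R \<Longrightarrow> b \<in> carrier R \<Longrightarrow> (I +> a) \<otimes>\<^bsub>R Quot I\<^esub> (I +> b) = I +> (a \<otimes> b)"
  by (rule ring_hom_mult[OF ideal.rcos_ring_hom, symmetric])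

lemma quot_eq_zero_iff:
  assumes "ideal I R" "a \<in> carrier R"
  shows "I +> a = \<zero>\<^bsub>R Quot I\<^esub> \<longleftrightarrow> a \<in> I"
proof -
  interpret I: ideal I R by fact
  show ?thesis unfolding zero_quot using I.rcos_const_imp_mem[OF assms(2)] I.a_rcos_const by (rule iffI)
qed

lemma quot_primeideal:
  assumes I: "ideal I R" and P: "primeideal P R" and IP: "I \<subseteq> P"
  shows "primeideal ((+>) I ` P) (R Quot I)"
proof (rule primeidealI)
  have PI: "ideal P R" using P primeideal.axioms(1) by auto
  note m = quot_mem_image_iff[OF I PI IP]
  show "ideal ((+>) I ` P) (R Quot I)" by (rule ring_ideal_imp_quot_ideal[OF I PI])
  show "cring (R Quot I)" by (rule ideal.quotient_is_cring[OF I is_cring])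
  have "\<one> \<notin> P" using ideal.one_imp_carrier[OF PI] primeideal.I_notcarr[OF P] by auto
  then have "I +> \<one> \<notin> (+>) I ` P" using m by simp
  then show "carrier (R Quot I) \<noteq> (+>) I ` P" by (auto simp: carrier_quot)
  fix a b assume "a \<in> carrier (R Quot I)" "b \<in> carrier (R Quot I)" and ab: "a \<otimes>\<^bsub>R Quot I\<^esub> b \<in> (+>) I ` P"
  then obtain x y where xy: "x \<in> carrier R" "y \<in> carrier R" "a = I +> x" "b = I +> y"
    by (auto simp: carrier_quot)
  then have "x \<otimes> y \<in> P" using ab m quot_mult[OF I] by simp
  then have "x \<in> P \<or> y \<in> P" using primeideal.I_prime[OF P] xy by auto
  then show "a \<in> (+>) I ` P \<or> b \<in> (+>) I ` P" using xy by auto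
qed

lemma lex_values_hom:
  assumes h: "ring_hom_ring R S h" and "set gs \<subseteq> carrier R" "w \<in> lex_values R gs"
  shows "h w \<in> lex_values S (map h gs)"
  using assms(2-)
proof (induction gs arbitrary: w)
  case Nil
  interpret h: ring_hom_ring R S h by fact
  show ?case using Nil by simp
next
  case (Cons g gs)
  interpret h: ring_hom_ring R S h by fact
  obtain a :: nat and q k where w: "w = g [^] a \<otimes> (q \<oplus> g \<otimes> k)" "q \<in> lex_values R gs" "k \<in> carrier R"
    using Cons.prems(2) by auto
  have gc: "g \<in> carrier R" "set gs \<subseteq> carrier R" using Cons.prems by auto
  have qc: "q \<in> carrier R" using lex_values_carrier[OF gc(2)] w by auto
  have "h w = h g [^]\<^bsub>S\<^esub> a \<otimes>\<^bsub>S\<^esub> (h q \<oplus>\<^bsub>S\<^esub> h g \<otimes>\<^bsub>S\<^esub> h k)"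
    using w(3) gc qc unfolding w(1) by (simp add: h.hom_nat_pow)
  moreover have "h q \<in> lex_values S (map h gs)" using Cons.IH gc w by auto
  ultimately show ?case unfolding list.map lex_values.simps using h.hom_closed[OF w(3)] by blast
qed

end

section \<open>The Noetherian property of the polynomial ring\<close>

text \<open>Choose repeatedly a position at which the minimum of a tail is attained.\<close>
lemma nondecreasing_subsequence:
  fixes a :: "nat \<Rightarrow> nat"
  shows "\<exists>\<phi> :: nat \<Rightarrow> nat. strict_mono \<phi> \<and> (\<forall>i j. i \<le> j \<longrightarrow> a (\<phi> i) \<le> a (\<phi> j))"
proof -
  have tail: "\<exists>n>N. \<forall>k\<ge>n. a n \<le> a k" for N
  proof -
    obtain n where n: "n > N" "\<And>k. k > N \<Longrightarrow> a n \<le> a k"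
      using ex_has_least_nat[of "\<lambda>n. n > N" "Suc N" a] by auto
    then show ?thesis by (intro exI[of _ n]) auto
  qed
  obtain \<phi> :: "nat \<Rightarrow> nat" where \<phi>: "\<And>n. (\<forall>k\<ge>\<phi> n. a (\<phi> n) \<le> a k) \<and> \<phi> n < \<phi> (Suc n)"
    using dependent_nat_choice[of "\<lambda>_ n. \<forall>k\<ge>n. a n \<le> a k" "\<lambda>_ m n. m < n"] tail by blast
  have sm: "strict_mono \<phi>" using \<phi> by (simp add: strict_mono_Suc_iff)
  then show ?thesis using \<phi> by (meson strict_mono_less_eq)
qed

lemma simultaneous_nondecreasing_subsequence:
  fixes t :: "nat \<Rightarrow> 'a \<Rightarrow> nat"
  assumes "finite X"
  shows "\<exists>\<phi> :: nat \<Rightarrow> nat. strict_mono \<phi> \<and> (\<forall>x\<in>X. \<forall>i j. i \<le> j \<longrightarrow> t (\<phi> i) x \<le> t (\<phi> j) x)"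
  using assms
proof (induction X rule: finite_induct)
  case empty
  then show ?case by (intro exI[of _ id]) (auto simp: strict_mono_def)
next
  case (insert x X)
  from insert.IH obtain \<phi> :: "nat \<Rightarrow> nat" where \<phi>0: "strict_mono \<phi> \<and> (\<forall>x\<in>X. \<forall>i j. i \<le> j \<longrightarrow> t (\<phi> i) x \<le> t (\<phi> j) x)"
    ..
  then have \<phi>: "strict_mono \<phi>" "x \<in> X \<Longrightarrow> i \<le> j \<Longrightarrow> t (\<phi> i) x \<le> t (\<phi> j) x" for x i j by simp_all
  from nondecreasing_subsequence[of "\<lambda>n. t (\<phi> n) x"] obtain \<psi> :: "nat \<Rightarrow> nat" where \<psi>0: "strict_mono \<psi> \<and> (\<forall>i j. i \<le> j \<longrightarrow> t (\<phi> (\<psi> i)) x \<le> t (\<phi> (\<psi> j)) x)"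
    ..
  then have \<psi>: "strict_mono \<psi>" "i \<le> j \<Longrightarrow> t (\<phi> (\<psi> i)) x \<le> t (\<phi> (\<psi> j)) x" for i j by simp_all
  have "t (\<phi> (\<psi> i)) y \<le> t (\<phi> (\<psi> j)) y" if "y \<in> insert x X" "i \<le> j" for y i j
    using that \<phi>(2) \<psi> by (metis insertE strict_mono_less_eq)
  then show ?case using \<phi>(1) \<psi>(1) by (intro exI[of _ "\<phi> \<circ> \<psi>"]) (auto simp: strict_mono_def)
qed

lemma Dickson:
  fixes t :: "nat \<Rightarrow> (nat \<Rightarrow>\<^sub>0 nat)"
  assumes "\<And>n. Poly_Mapping.keys (t n) \<subseteq> X" "finite X"
  shows "\<exists>i j s. i < j \<and> t j = t i + s"
proof -
  obtain \<phi> :: "nat \<Rightarrow> nat" where \<phi>: "strict_mono \<phi>"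
    "\<And>x. x \<in> X \<Longrightarrow> Poly_Mapping.lookup (t (\<phi> 0)) x \<le> Poly_Mapping.lookup (t (\<phi> 1)) x"
    using simultaneous_nondecreasing_subsequence[OF assms(2), of "\<lambda>n. Poly_Mapping.lookup (t n)"] by force
  have "Poly_Mapping.lookup (t (\<phi> 0)) x \<le> Poly_Mapping.lookup (t (\<phi> 1)) x" for x
  proof (cases "x \<in> X")
    case False
    then have "x \<notin> Poly_Mapping.keys (t (\<phi> 0))" using assms(1) by blast
    then show ?thesis by (simp add: in_keys_iff)
  qed (rule \<phi>(2))
  then have "t (\<phi> 1) = t (\<phi> 0) + (t (\<phi> 1) - t (\<phi> 0))"
    by (intro poly_mapping_eqI) (simp add: lookup_add lookup_minus)
  moreover have "\<phi> 0 < \<phi> 1" using \<phi>(1) by (simp add: strict_mono_def)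
  ultimately show ?thesis by blast
qed

lemma lookup_single_mult_add:
  fixes s :: "nat \<Rightarrow>\<^sub>0 nat" and q :: "'k::field mpoly"
  shows "Poly_Mapping.lookup (Poly_Mapping.single s a * q) (s + t) = a * Poly_Mapping.lookup q t"
proof -
  have "Poly_Mapping.single s a * q =
    (\<Sum>u\<in>Poly_Mapping.keys q. Poly_Mapping.single (s + u) (a * Poly_Mapping.lookup q u))"
    by (subst sum_single_keys[of "Poly_Mapping.keys q" q, symmetric])
      (simp_all add: sum_distrib_left mult_single)
  then show ?thesis
    by (simp add: lookup_sum lookup_single when_def in_keys_iff sum.delta')
qed

lemma monomial_order_nonneg: "0 \<le> (s :: nat \<Rightarrow>\<^sub>0 nat)"
proof (rule leI, rule notI)
  assume "s < 0"
  then show False by transfer (simp add: less_fun_def)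
qed

text \<open>If each \<open>v\<^sub>n\<close> lay outside the ideal \<open>J\<^sub>n\<close> of its predecessors, choose in every coset \<open>v\<^sub>n + J\<^sub>n\<close> an
element \<open>q\<^sub>n\<close> whose leading monomial is least. By Dickson's lemma, the leading monomial of some \<open>q\<^sub>i\<close>
divides that of a later \<open>q\<^sub>j\<close>. As \<open>q\<^sub>i \<in> J\<^sub>j\<close>, subtracting a multiple of \<open>q\<^sub>i\<close> from \<open>q\<^sub>j\<close> stays within the
coset and lowers the leading monomial. Dickson's lemma also provides the least elements: the
monomial order is lexicographic in the variables and therefore well-founded only on monomials in
finitely many of them.\<close>
lemma poly_ring_noetherian_sequence:
  fixes v :: "nat \<Rightarrow> 'k::field mpoly"
  assumes v: "\<And>n. v n \<in> carrier (poly_ring m)"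
  shows "\<exists>n. v n \<in> Idl\<^bsub>poly_ring m\<^esub> (v ` {..<n})"
proof (rule ccontr)
  assume "\<not> ?thesis"
  then have neg: "v n \<notin> Idl\<^bsub>poly_ring m\<^esub> (v ` {..<n})" for n by blast
  define J where "J n = Idl\<^bsub>poly_ring m\<^esub> (v ` {..<n})" for n
  have vs: "v ` X \<subseteq> carrier (poly_ring m)" for X using v by auto
  have J: "ideal (J n) (poly_ring m)" for n unfolding J_def by (rule poly_ring.genideal_ideal[OF vs])
  have vJ: "v i \<in> J n" if "i < n" for i n
    using poly_ring.genideal_self[OF vs, of "{..<n}"] that unfolding J_def by blast
  have JJ: "J i \<subseteq> J j" if "i \<le> j" for i j
    using vJ that unfolding J_def[of i] by (intro poly_ring.genideal_minimal[OF J]) auto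
  define lm :: "'k mpoly \<Rightarrow> (nat \<Rightarrow>\<^sub>0 nat)" where "lm q = Max (Poly_Mapping.keys q)" for q
  define C where "C n = {q \<in> carrier (poly_ring m). q - v n \<in> J n}" for n
  have C0: "q \<noteq> 0" if "q \<in> C n" for q n
  proof
    assume "q = 0"
    then have "- v n \<in> J n" using that by (simp add: C_def)
    then have "0 - (- v n) \<in> J n" by (rule poly_ideal_diff[OF J poly_ideal_zero[OF J]])
    then show False using neg by (simp add: J_def)
  qed
  have lmk: "lm q \<in> Poly_Mapping.keys q" "\<And>t. t \<in> Poly_Mapping.keys q \<Longrightarrow> t \<le> lm q" if "q \<noteq> 0" for q
    using that by (auto simp: lm_def)
  have lmX: "Poly_Mapping.keys (lm q) \<subseteq> {1..m}" if "q \<in> C n" for q n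
    using lmk(1)[OF C0[OF that]] that by (auto simp: C_def mem_poly_ring)
  have wf: "wf {(s :: nat \<Rightarrow>\<^sub>0 nat, t :: nat \<Rightarrow>\<^sub>0 nat). s < t \<and> Poly_Mapping.keys s \<subseteq> {1..m} \<and> Poly_Mapping.keys t \<subseteq> {1..m}}" (is "wf ?r")
  proof (unfold wf_iff_no_infinite_down_chain, rule notI, elim exE)
    fix f :: "nat \<Rightarrow> (nat \<Rightarrow>\<^sub>0 nat)" assume f: "\<forall>i. (f (Suc i), f i) \<in> ?r"
    then have "Poly_Mapping.keys (f n) \<subseteq> {1..m}" for n by blast
    then obtain i j s where ij: "i < j" "f j = f i + s" using Dickson[of f "{1..m}"] by auto
    have step: "f (Suc k) < f k" for k using f by blast
    have "f (i + Suc k) < f i" for k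
    proof (induction k)
      case (Suc k)
      then show ?case using step[of "i + Suc k"] by simp
    qed (simp add: step)
    from this[of "j - Suc i"] have "f j < f i" using ij(1) by simp
    moreover have "f i \<le> f j" unfolding ij(2)
      using add_left_mono[OF monomial_order_nonneg[of s], of "f i"] by simp
    ultimately show False by simp
  qed
  have "\<exists>q\<in>C n. \<forall>p\<in>C n. \<not> lm p < lm q" for n
  proof -
    have "v n \<in> C n" using v poly_ideal_zero[OF J] by (simp add: C_def)
    then have "lm (v n) \<in> lm ` C n" by simp
    from wf[unfolded wf_eq_minimal, rule_format, OF this]
    obtain z where z0: "z \<in> lm ` C n" "\<forall>y. (y, z) \<in> ?r \<longrightarrow> y \<notin> lm ` C n" by blast
    then have z: "z \<in> lm ` C n" "(y, z) \<in> ?r \<Longrightarrow> y \<notin> lm ` C n" for y by simp_all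
    then obtain q where q: "q \<in> C n" "z = lm q" by blast
    have "\<not> lm p < lm q" if "p \<in> C n" for p
      using z(2)[of "lm p"] q lmX[OF that] lmX[OF q(1)] that by auto
    then show ?thesis using q by blast
  qed
  then obtain q where q: "\<And>n. q n \<in> C n" "\<And>n p. p \<in> C n \<Longrightarrow> \<not> lm p < lm (q n)" by metis
  obtain i j s where ij: "i < j" "lm (q j) = lm (q i) + s"
    using Dickson[of "\<lambda>n. lm (q n)" "{1..m}"] lmX[OF q(1)] by auto
  define a where "a = Poly_Mapping.lookup (q j) (lm (q j)) / Poly_Mapping.lookup (q i) (lm (q i))"
  define x where "x = Poly_Mapping.single s a"
  define p where "p = q j - x * q i"
  have qi: "q i \<in> J j"
  proof -
    have "q i - v i + v i \<in> J j"
      using q(1)[of i] JJ[of i j] vJ ij by (intro poly_ideal_add[OF J]) (auto simp: C_def)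
    then show ?thesis by simp
  qed
  have "Poly_Mapping.keys s \<subseteq> {1..m}" using lmX[OF q(1), of j] ij(2) by (simp add: keys_add_nat)
  then have xc: "x \<in> carrier (poly_ring m)" by (simp add: x_def poly_ring_closed)
  have qc: "q n \<in> carrier (poly_ring m)" for n using q(1) by (simp add: C_def)
  have pC: "p \<in> C j"
  proof -
    have "q j - v j \<in> J j" using q(1)[of j] by (simp add: C_def)
    then have "q j - v j - x * q i \<in> J j" by (rule poly_ideal_diff[OF J _ poly_ideal_mult[OF J qi xc]])
    moreover have "q j - v j - x * q i = p - v j" by (simp add: p_def)
    moreover have "p \<in> carrier (poly_ring m)"
      unfolding p_def by (rule poly_ring_closed(3)[OF qc poly_ring_closed(1)[OF xc qc]])
    ultimately show ?thesis by (simp add: C_def)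
  qed
  have lx: "Poly_Mapping.keys (x * q i) \<subseteq> (\<lambda>t. s + t) ` Poly_Mapping.keys (q i)"
    using keys_mult[of x "q i"] by (auto simp: x_def split: if_splits)
  have cancel: "Poly_Mapping.lookup p (lm (q j)) = 0"
  proof -
    have "Poly_Mapping.lookup (x * q i) (s + lm (q i)) = a * Poly_Mapping.lookup (q i) (lm (q i))"
      unfolding x_def by (rule lookup_single_mult_add)
    then show ?thesis using lmk(1)[OF C0[OF q(1)[of i]]]
      by (simp add: p_def lookup_minus ij(2) add.commute a_def in_keys_iff)
  qed
  have "lm p < lm (q j)"
  proof -
    have k: "lm p \<in> Poly_Mapping.keys p" using lmk(1)[OF C0[OF pC]] .
    have "lm p \<noteq> lm (q j)" using k cancel by (auto simp: in_keys_iff)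
    moreover have "lm p \<le> lm (q j)"
    proof -
      have "lm p \<in> Poly_Mapping.keys (q j) \<or> lm p \<in> Poly_Mapping.keys (x * q i)"
        using k by (auto simp: p_def in_keys_iff lookup_minus)
      then show ?thesis
      proof
        assume "lm p \<in> Poly_Mapping.keys (q j)"
        then show ?thesis using lmk(2)[OF C0[OF q(1)]] by blast
      next
        assume "lm p \<in> Poly_Mapping.keys (x * q i)"
        then obtain t where t: "t \<in> Poly_Mapping.keys (q i)" "lm p = s + t" using lx by auto
        show ?thesis unfolding t(2) ij(2) using lmk(2)[OF C0[OF q(1)] t(1)]
          by (simp add: add.commute add_mono)
      qed
    qed
    ultimately show ?thesis by simp
  qed
  then show False using q(2)[OF pC] by simp
qed


section \<open>Dimension and depth of quotients by monomial conditions\<close>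

lemma irrelevant_ideal_eq: "irrelevant_ideal m = (off_face_ideal m {} :: 'k::field mpoly set)"
proof
  have off: "p \<in> off_face_ideal m {} \<longleftrightarrow> p \<in> carrier (poly_ring m) \<and> (\<forall>t\<in>Poly_Mapping.keys p. t \<noteq> 0)" for p :: "'k mpoly"
    by (auto simp: off_face_ideal_def monomial_ideal_def)
  have vars: "mvar ` {1..m} \<subseteq> carrier (poly_ring m :: 'k mpoly ring)"
    by (auto intro!: poly_ring_closed)
  note irr = poly_ring.genideal_ideal[OF vars, folded irrelevant_ideal_def]
  show "irrelevant_ideal m \<subseteq> (off_face_ideal m {} :: 'k mpoly set)"
    unfolding irrelevant_ideal_def
  proof (rule poly_ring.genideal_minimal[OF ideal_off_face])
    have "Poly_Mapping.single i (1::nat) \<noteq> 0" for i :: nat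
      by (metis lookup_single_eq lookup_zero zero_neq_one)
    then show "mvar ` {1..m} \<subseteq> (off_face_ideal m {} :: 'k mpoly set)"
      using vars by (auto simp: off mvar_def)
  qed
  show "off_face_ideal m {} \<subseteq> (irrelevant_ideal m :: 'k mpoly set)"
  proof
    fix p :: "'k mpoly" assume p: "p \<in> off_face_ideal m {}"
    show "p \<in> irrelevant_ideal m"
    proof (rule poly_ideal_memI[OF irr])
      fix t assume t: "t \<in> Poly_Mapping.keys p"
      have tm: "Poly_Mapping.keys t \<subseteq> {1..m}" and "t \<noteq> 0" using p t by (auto simp: off mem_poly_ring)
      then obtain i where i: "i \<in> Poly_Mapping.keys t" by fastforce
      define u where "u = t - Poly_Mapping.single i 1"
      have tu: "t = u + Poly_Mapping.single i 1"
        using i by (intro poly_mapping_eqI) (auto simp: u_def lookup_add lookup_minus lookup_single when_def in_keys_iff)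
      have "Poly_Mapping.keys u \<subseteq> {1..m}" using tm unfolding tu keys_add_nat by auto
      then have "monomial u * mvar i \<in> (irrelevant_ideal m :: 'k mpoly set)"
        using poly_ring.genideal_self[OF vars] i tm
        by (intro poly_ideal_mult[OF irr] poly_ring_closed) (auto simp: irrelevant_ideal_def)
      then show "monomial t \<in> (irrelevant_ideal m :: 'k mpoly set)"
        by (simp add: tu mvar_def mult_single)
    qed
  qed
qed

lemma primeideal_irrelevant: "primeideal (irrelevant_ideal m) (poly_ring m)"
  unfolding irrelevant_ideal_eq by (rule primeideal_off_face)

lemma off_face_ideal_antimono: "F \<subseteq> G \<Longrightarrow> off_face_ideal m G \<subseteq> off_face_ideal m F"
  by (auto simp: off_face_ideal_def monomial_ideal_def)

text \<open>Removing the elements of \<open>F\<close> one by one produces a chain of \<open>card F + 1\<close> primes above \<open>I\<close>.\<close>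
lemma krull_dim_quot_ge:
  fixes I :: "'k::field mpoly set"
  assumes I: "ideal I (poly_ring m)" and F: "F \<subseteq> {1..m}" and IF: "I \<subseteq> off_face_ideal m F"
  shows "enat (card F) \<le> krull_dim (poly_ring m Quot I)"
proof -
  define xs where "xs = sorted_list_of_set F"
  have finF: "finite F" using F finite_subset by blast
  have xs: "set xs = F" "distinct xs" "length xs = card F"
    using finF by (simp_all add: xs_def)
  define P :: "nat \<Rightarrow> 'k mpoly set" where "P i = off_face_ideal m (set (drop i xs))" for i
  define Q where "Q i = (+>\<^bsub>poly_ring m\<^esub>) I ` (P i :: 'k mpoly set)" for i
  have IP: "I \<subseteq> P i" for i
    using IF off_face_ideal_antimono[of "set (drop i xs)" F m] set_drop_subset[of i xs] xs by (auto simp: P_def)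
  have prime: "primeideal (Q i) (poly_ring m Quot I)" for i
    unfolding Q_def by (rule poly_ring.quot_primeideal[OF I _ IP]) (simp add: P_def primeideal_off_face)
  have strict: "Q i \<subset> Q (Suc i)" if i: "i < card F" for i
  proof -
    have "P i \<subseteq> P (Suc i)" unfolding P_def by (intro off_face_ideal_antimono set_drop_subset_set_drop) simp
    then have "Q i \<subseteq> Q (Suc i)" by (auto simp: Q_def)
    moreover have "Q i \<noteq> Q (Suc i)"
    proof
      assume eq: "Q i = Q (Suc i)"
      have ix: "i < length xs" using i xs by simp
      have d: "drop i xs = xs ! i # drop (Suc i) xs" using Cons_nth_drop_Suc[OF ix] by simp
      have "distinct (drop i xs)" using xs by simp
      then have n: "xs ! i \<notin> set (drop (Suc i) xs)" by (simp add: d)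
      have "xs ! i \<in> F" using nth_mem[OF ix] xs by simp
      then have c: "mvar (xs ! i) \<in> carrier (poly_ring m :: 'k mpoly ring)" using F by (intro poly_ring_closed) auto
      have in1: "mvar (xs ! i) \<in> (P (Suc i) :: 'k mpoly set)"
        using c n by (simp add: P_def off_face_ideal_def monomial_ideal_def mvar_def)
      have out: "mvar (xs ! i) \<notin> (P i :: 'k mpoly set)"
        by (simp add: P_def d off_face_ideal_def monomial_ideal_def mvar_def)
      have "I +>\<^bsub>poly_ring m\<^esub> mvar (xs ! i) \<in> Q (Suc i)" unfolding Q_def using in1 by (rule imageI)
      then have "I +>\<^bsub>poly_ring m\<^esub> mvar (xs ! i) \<in> Q i" unfolding eq .
      then have "mvar (xs ! i) \<in> (P i :: 'k mpoly set)"
        unfolding Q_def P_def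
        by (rule poly_ring.quot_mem_image_iff[OF I ideal_off_face IP[unfolded P_def] c, THEN iffD1])
      then show False using out by contradiction
    qed
    ultimately show ?thesis by blast
  qed
  have "card F \<in> {l. \<exists>P. (\<forall>i\<le>l. primeideal (P i) (poly_ring m Quot I)) \<and> (\<forall>i<l. P i \<subset> P (Suc i))}"
    using prime strict by blast
  then show ?thesis unfolding krull_dim_def by (rule SUP_upper)
qed

text \<open>A chain of more than \<open>k\<close> steps yields more than \<open>k\<close> polynomials, one from each step. A
lexicographic value of them has no monomial on any \<open>F\<close>, hence lies in \<open>I\<close> and so in the bottom
prime, which is impossible.\<close>
lemma krull_dim_quot_le:
  fixes I :: "'k::field mpoly set"
  assumes I: "ideal I (poly_ring m)"
    and FF: "finite FF" "\<And>F. F \<in> FF \<Longrightarrow> F \<subseteq> {1..m} \<and> card F \<le> k"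
    and inI: "\<And>w. w \<in> carrier (poly_ring m) \<Longrightarrow> (\<forall>F\<in>FF. w \<in> off_face_ideal m F) \<Longrightarrow> w \<in> I"
  shows "krull_dim (poly_ring m Quot I) \<le> enat k"
  unfolding krull_dim_def
proof (rule SUP_least, clarify)
  let ?R = "poly_ring m :: 'k mpoly ring" and ?S = "poly_ring m Quot I"
  interpret S: cring ?S by (rule ideal.quotient_is_cring[OF I poly_ring_cring])
  fix l P assume P: "\<forall>i\<le>l. primeideal (P i) ?S" "\<forall>i<l. P i \<subset> P (Suc i)"
  show "enat l \<le> enat k"
  proof (rule ccontr)
    assume "\<not> enat l \<le> enat k"
    then have kl: "k < l" by simp
    have "\<exists>g\<in>carrier ?R. I +>\<^bsub>?R\<^esub> g \<in> P (Suc i) - P i" if i: "i < l" for i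
    proof -
      obtain f where f: "f \<in> P (Suc i) - P i" using P(2) i by blast
      have "f \<in> carrier ?S" using f i P(1) ideal.Icarr[OF primeideal.axioms(1)] by (metis DiffD1 Suc_leI)
      then obtain a where "a \<in> carrier ?R" "f = I +>\<^bsub>?R\<^esub> a" unfolding poly_ring.carrier_quot by blast
      then show ?thesis using f by blast
    qed
    then obtain g where g: "\<And>i. i < l \<Longrightarrow> g i \<in> carrier ?R \<and> I +>\<^bsub>?R\<^esub> g i \<in> P (Suc i) - P i" by metis
    define gs where "gs = map g [0..<l]"
    have gs: "set gs \<subseteq> carrier ?R" "length gs = l" using g by (auto simp: gs_def)
    obtain w where w: "w \<in> lex_values ?R gs" "\<forall>F\<in>FF. w \<in> off_face_ideal m F"
      using lex_values_meet_off_faces[OF gs(1) FF] kl gs(2) by blast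
    have wc: "w \<in> carrier ?R" using w(1) poly_ring.lex_values_carrier[OF gs(1)] by auto
    have "w \<in> I" using inI wc w(2) by blast
    then have "I +>\<^bsub>?R\<^esub> w = \<zero>\<^bsub>?S\<^esub>" using poly_ring.quot_eq_zero_iff[OF I wc] by simp
    moreover have "I +>\<^bsub>?R\<^esub> w \<in> lex_values ?S (map ((+>\<^bsub>?R\<^esub>) I) gs)"
      by (rule poly_ring.lex_values_hom[OF ideal.rcos_ring_hom_ring[OF I] gs(1) w(1)])
    moreover have "\<zero>\<^bsub>?S\<^esub> \<in> P 0"
      using P(1) additive_subgroup.zero_closed[OF ideal.axioms(1)[OF primeideal.axioms(1)]] by blast
    moreover have "lex_values ?S (map ((+>\<^bsub>?R\<^esub>) I) gs) \<inter> P 0 = {}"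
    proof (rule S.lex_values_avoid_prime_chain)
      show "set (map ((+>\<^bsub>?R\<^esub>) I) gs) \<subseteq> carrier ?S" using gs(1) unfolding poly_ring.carrier_quot by auto
      show "primeideal (P i) ?S" if "i \<le> length (map ((+>\<^bsub>?R\<^esub>) I) gs)" for i
        using that gs(2) P(1) by simp
      show "P i \<subseteq> P (Suc i)" if "i < length (map ((+>\<^bsub>?R\<^esub>) I) gs)" for i
        using that gs(2) P(2) by auto
      show "map ((+>\<^bsub>?R\<^esub>) I) gs ! i \<in> P (Suc i) - P i" if "i < length (map ((+>\<^bsub>?R\<^esub>) I) gs)" for i
        using that gs(2) g[of i] by (simp add: gs_def)
    qed
    ultimately show False by auto
  qed
qed

text \<open>The element \<open>u\<close> has the prime of \<open>F\<close> as its annihilator modulo \<open>I\<close>. A sequence in the irrelevant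
ideal with more than \<open>card F\<close> elements has a lexicographic value in this prime, so it cannot be
regular.\<close>
lemma depth_quot_le:
  fixes I :: "'k::field mpoly set"
  assumes I: "ideal I (poly_ring m)" and F: "F \<subseteq> {1..m}" and IF: "I \<subseteq> off_face_ideal m F"
    and u: "u \<in> carrier (poly_ring m)" "u \<notin> off_face_ideal m F"
      "\<And>g. g \<in> off_face_ideal m F \<Longrightarrow> g * u \<in> I"
  shows "depth (poly_ring m Quot I) ((\<lambda>f. I +>\<^bsub>poly_ring m\<^esub> f) ` irrelevant_ideal m) \<le> enat (card F)"
  unfolding depth_def
proof (rule SUP_least, clarify)
  let ?R = "poly_ring m :: 'k mpoly ring" and ?S = "poly_ring m Quot I"
  let ?\<pi> = "(+>\<^bsub>?R\<^esub>) I"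
  interpret S: cring ?S by (rule ideal.quotient_is_cring[OF I poly_ring_cring])
  interpret h: ring_hom_ring ?R ?S ?\<pi> by (rule ideal.rcos_ring_hom_ring[OF I])
  fix fs assume reg: "regular_sequence ?S fs" and fs: "set fs \<subseteq> ?\<pi> ` irrelevant_ideal m"
  have IM: "I \<subseteq> irrelevant_ideal m"
    using IF off_face_ideal_antimono[of "{}" F m] unfolding irrelevant_ideal_eq by blast
  let ?M = "?\<pi> ` irrelevant_ideal m"
  have M: "primeideal ?M ?S" by (rule poly_ring.quot_primeideal[OF I primeideal_irrelevant IM])
  have irrc: "irrelevant_ideal m \<subseteq> carrier ?R"
    by (auto simp: irrelevant_ideal_eq off_face_ideal_def monomial_ideal_def)
  have offc: "off_face_ideal m F \<subseteq> carrier ?R"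
    by (auto simp: off_face_ideal_def monomial_ideal_def)
  show "enat (length fs) \<le> enat (card F)"
  proof (rule ccontr)
    assume "\<not> enat (length fs) \<le> enat (card F)"
    then have len: "card F < length fs" by simp
    obtain g where g: "\<And>f. f \<in> set fs \<Longrightarrow> g f \<in> irrelevant_ideal m \<and> f = ?\<pi> (g f)"
    proof -
      have "\<forall>f\<in>set fs. \<exists>a. a \<in> irrelevant_ideal m \<and> f = ?\<pi> a" using fs by blast
      from bchoice[OF this] show ?thesis using that by blast
    qed
    define gs where "gs = map g fs"
    have gs: "set gs \<subseteq> carrier ?R" "length gs = length fs" "map ?\<pi> gs = fs"
      using g irrc by (auto simp: gs_def intro!: map_idI)
    obtain w where w: "w \<in> lex_values ?R gs" "w \<in> off_face_ideal m F"
      using lex_values_meet_off_faces[OF gs(1), of "{F}" "card F"] F len gs(2) by auto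
    have "?\<pi> w \<in> lex_values ?S fs"
      using poly_ring.lex_values_hom[OF ideal.rcos_ring_hom_ring[OF I] gs(1) w(1)] gs(3) by simp
    moreover have "lex_values ?S fs \<inter> ?\<pi> ` off_face_ideal m F = {}"
    proof (rule S.regular_sequence_avoids_annihilator[OF M _ fs S.zeroideal])
      show "\<exists>n. v n \<in> Idl\<^bsub>?S\<^esub> (v ` {..<n})" if v: "\<And>n. v n \<in> carrier ?S" for v :: "nat \<Rightarrow> _"
      proof -
        have "\<exists>a. a \<in> carrier ?R \<and> v n = ?\<pi> a" for n using v[of n] unfolding poly_ring.carrier_quot by blast
        then obtain a where a: "\<And>n. a n \<in> carrier ?R" "\<And>n. v n = ?\<pi> (a n)" by metis
        obtain n where n: "a n \<in> Idl\<^bsub>?R\<^esub> (a ` {..<n})" using poly_ring_noetherian_sequence[of a m] a(1) by blast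
        have s: "a ` {..<n} \<subseteq> carrier ?R" using a(1) by auto
        have Is: "I \<union> a ` {..<n} \<subseteq> carrier ?R" using s ideal.Icarr[OF I] by auto
        have "Idl\<^bsub>?R\<^esub> (a ` {..<n}) \<subseteq> Idl\<^bsub>?R\<^esub> (I \<union> a ` {..<n})"
          using poly_ring.genideal_self[OF Is]
          by (intro poly_ring.genideal_minimal poly_ring.genideal_ideal Is) blast
        then have "?\<pi> (a n) \<in> Idl\<^bsub>?S\<^esub> (?\<pi> ` a ` {..<n})"
          using n poly_ring.quot_Idl_iff[OF I s a(1)] by blast
        moreover have "?\<pi> ` a ` {..<n} = v ` {..<n}" using a(2) by (auto simp: image_image)
        ultimately show ?thesis using a(2) by metis
      qed
      have Idl0: "Idl\<^bsub>?S\<^esub> ({\<zero>\<^bsub>?S\<^esub>} \<union> X) = Idl\<^bsub>?S\<^esub> X" if X: "X \<subseteq> carrier ?S" for X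
      proof
        have X0: "{\<zero>\<^bsub>?S\<^esub>} \<union> X \<subseteq> carrier ?S" using X by auto
        show "Idl\<^bsub>?S\<^esub> ({\<zero>\<^bsub>?S\<^esub>} \<union> X) \<subseteq> Idl\<^bsub>?S\<^esub> X"
          using S.genideal_self[OF X] additive_subgroup.zero_closed[OF ideal.axioms(1)[OF S.genideal_ideal[OF X]]]
          by (intro S.genideal_minimal S.genideal_ideal X) blast
        show "Idl\<^bsub>?S\<^esub> X \<subseteq> Idl\<^bsub>?S\<^esub> ({\<zero>\<^bsub>?S\<^esub>} \<union> X)"
          using S.genideal_self[OF X0] by (intro S.genideal_minimal S.genideal_ideal X0) blast
      qed
      show "a \<in> Idl\<^bsub>?S\<^esub> ({\<zero>\<^bsub>?S\<^esub>} \<union> set (take i fs))"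
        if "i < length fs" "a \<in> carrier ?S" "fs ! i \<otimes>\<^bsub>?S\<^esub> a \<in> Idl\<^bsub>?S\<^esub> ({\<zero>\<^bsub>?S\<^esub>} \<union> set (take i fs))" for i a
      proof -
        have "set (take i fs) \<subseteq> carrier ?S" using reg set_take_subset[of i fs] by (auto simp: regular_sequence_def)
        note eq = Idl0[OF this]
        show ?thesis using reg that unfolding eq regular_sequence_def by blast
      qed
      show "?\<pi> ` off_face_ideal m F \<subseteq> carrier ?S" unfolding poly_ring.carrier_quot by (rule image_mono[OF offc])
      show "?\<pi> u \<in> carrier ?S" unfolding poly_ring.carrier_quot by (rule imageI[OF u(1)])
      show "?\<pi> u \<notin> S.local_closure ?M {\<zero>\<^bsub>?S\<^esub>}"
      proof
        assume "?\<pi> u \<in> S.local_closure ?M {\<zero>\<^bsub>?S\<^esub>}"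
        then obtain s where s: "s \<in> carrier ?S - ?M" "s \<otimes>\<^bsub>?S\<^esub> ?\<pi> u = \<zero>\<^bsub>?S\<^esub>"
          unfolding S.local_closure_def by blast
        then obtain b where b: "b \<in> carrier ?R" "s = ?\<pi> b" unfolding poly_ring.carrier_quot by blast
        have bu: "b \<otimes>\<^bsub>?R\<^esub> u \<in> carrier ?R" using b u by simp
        have "?\<pi> (b \<otimes>\<^bsub>?R\<^esub> u) = \<zero>\<^bsub>?S\<^esub>" using s(2) b poly_ring.quot_mult[OF I b(1) u(1)] by simp
        then have "b \<otimes>\<^bsub>?R\<^esub> u \<in> off_face_ideal m F" using poly_ring.quot_eq_zero_iff[OF I bu] IF by blast
        then have "b \<in> off_face_ideal m F"
          using primeideal.I_prime[OF primeideal_off_face b(1) u(1)] u(2) by blast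
        then have "b \<in> irrelevant_ideal m"
          using off_face_ideal_antimono[of "{}" F m] unfolding irrelevant_ideal_eq by blast
        then show False using s(1) b(2) by blast
      qed
      show "g \<otimes>\<^bsub>?S\<^esub> ?\<pi> u \<in> S.local_closure ?M {\<zero>\<^bsub>?S\<^esub>}" if "g \<in> ?\<pi> ` off_face_ideal m F" for g
      proof -
        obtain b where b: "b \<in> off_face_ideal m F" "g = ?\<pi> b" using \<open>g \<in> _\<close> by blast
        have bc: "b \<in> carrier ?R" using b(1) offc by blast
        have "b \<otimes>\<^bsub>?R\<^esub> u \<in> I" using u(3)[OF b(1)] by (simp add: poly_ring_sel)
        then have "?\<pi> (b \<otimes>\<^bsub>?R\<^esub> u) = \<zero>\<^bsub>?S\<^esub>" using poly_ring.quot_eq_zero_iff[OF I poly_ring.m_closed[OF bc u(1)]] by blast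
        then have "g \<otimes>\<^bsub>?S\<^esub> ?\<pi> u = \<zero>\<^bsub>?S\<^esub>" using b(2) poly_ring.quot_mult[OF I bc u(1)] by simp
        then show ?thesis using S.local_closure_superset[OF M S.zeroideal] by auto
      qed
    qed
    ultimately show False using w(2) by blast
  qed
qed

section \<open>The ideal generated by the images of the path\<close>

text \<open>The independent sets of the graph that joins any two vertices at distance less than \<open>d\<close>.\<close>
definition has_gaps :: "nat \<Rightarrow> nat set \<Rightarrow> bool"
  where "has_gaps d F \<longleftrightarrow> (\<forall>i\<in>F. \<forall>j\<in>F. i < j \<longrightarrow> d \<le> j - i)"

definition gap_ideal :: "nat \<Rightarrow> nat \<Rightarrow> 'k::field mpoly set"
  where "gap_ideal m d = monomial_ideal m (\<lambda>t. \<not> has_gaps d (Poly_Mapping.keys t))"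

lemma has_gaps_mono: "F \<subseteq> G \<Longrightarrow> has_gaps d G \<Longrightarrow> has_gaps d F"
  by (auto simp: has_gaps_def)

lemma mem_gap_ideal:
  "p \<in> gap_ideal m d \<longleftrightarrow> p \<in> carrier (poly_ring m) \<and> (\<forall>t. has_gaps d (Poly_Mapping.keys t) \<longrightarrow> Poly_Mapping.lookup p t = 0)"
  by (auto simp: gap_ideal_def monomial_ideal_def in_keys_iff)

lemma ideal_gap_ideal: "ideal (gap_ideal m d) (poly_ring m)"
  unfolding gap_ideal_def
  by (rule ideal_monomial_ideal) (auto simp: keys_add_nat dest: has_gaps_mono[rotated])

lemma mvar_mult_mvar: "mvar i * mvar j = monomial (Poly_Mapping.single i 1 + Poly_Mapping.single j 1)"
  by (simp add: mvar_def mult_single)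

lemma monomial_mem_gap_ideal:
  assumes "Poly_Mapping.keys t \<subseteq> {1..m}" "i \<in> Poly_Mapping.keys t" "j \<in> Poly_Mapping.keys t" "i < j" "j - i < d"
  shows "monomial t \<in> gap_ideal m d"
proof -
  have "\<not> has_gaps d (Poly_Mapping.keys t)" using assms(2-) unfolding has_gaps_def by (meson not_le)
  then show ?thesis using assms(1) by (simp add: gap_ideal_def monomial_ideal_def mem_poly_ring)
qed

lemma monomial_prod:
  "finite K \<Longrightarrow> (\<Prod>i\<in>K. mvar (f i) ^ e i) =
    (monomial (\<Sum>i\<in>K. Poly_Mapping.single (f i) (e i)) :: 'k::field mpoly)"
proof (induction K rule: finite_induct)
  case (insert x K)
  have "(mvar i :: 'k mpoly) ^ n = monomial (Poly_Mapping.single i n)" for i n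
    by (induction n) (simp_all add: mvar_def mult_single single_add[symmetric])
  then show ?case using insert by (simp add: mult_single)
qed simp

lemma strict_mono_on_spread:
  assumes "strict_mono_on {1..n} (\<pi> :: nat \<Rightarrow> nat)" "1 \<le> i" "i \<le> j" "j \<le> n"
  shows "\<pi> i + (j - i) \<le> \<pi> j"
  using assms(3,4)
proof (induction j rule: dec_induct)
  case (step k)
  have "\<pi> k < \<pi> (Suc k)" using step assms(2) by (intro strict_mono_onD[OF assms(1)]) auto
  then show ?case using step by simp
qed simp

text \<open>There are \<open>i - 1\<close> values of \<open>\<pi>\<close> below \<open>\<pi> i\<close> and \<open>n - i\<close> above it, all in \<open>{1..n + r}\<close>.\<close>
lemma Inc_spread:
  assumes "\<pi> \<in> Inc n (n + r)" "i \<in> {1..n}"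
  shows "i \<le> \<pi> i \<and> \<pi> i \<le> i + r"
proof -
  have sm: "strict_mono_on {1..n} \<pi>" and r: "\<And>x. x \<in> {1..n} \<Longrightarrow> \<pi> x \<in> {1..n + r}"
    using assms(1) by (auto simp: Inc_def)
  have "1 \<le> \<pi> 1" "\<pi> n \<le> n + r" using r[of 1] r[of n] assms(2) by auto
  then show ?thesis
    using strict_mono_on_spread[OF sm, of 1 i] strict_mono_on_spread[OF sm, of i n] assms(2) by auto
qed

lemma edge_ideal_line_graph_subset: "edge_ideal n (line_graph n) \<subseteq> (gap_ideal n 2 :: 'k::field mpoly set)"
  unfolding edge_ideal_def
proof (rule poly_ring.genideal_minimal[OF ideal_gap_ideal], clarify)
  fix i j assume "{i, j} \<in> line_graph n"
  then obtain k where k: "{i, j} = {k, k + 1}" "1 \<le> k" "k + 1 \<le> n" by (auto simp: line_graph_def)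
  then have "(i = k \<and> j = k + 1) \<or> (i = k + 1 \<and> j = k)" by (auto simp: doubleton_eq_iff)
  then show "mvar i * mvar j \<in> (gap_ideal n 2 :: 'k mpoly set)"
    unfolding mvar_mult_mvar using k(2,3)
    by (intro monomial_mem_gap_ideal[of _ _ k "k + 1"]) (auto simp: keys_add_nat)
qed

lemma induced_hom_mem_gap_ideal:
  fixes p :: "'k::field mpoly"
  assumes \<pi>: "\<pi> \<in> Inc n (n + r)" and p: "p \<in> gap_ideal n 2"
  shows "induced_hom \<pi> p \<in> gap_ideal (n + r) (r + 2)"
  unfolding induced_hom_def
proof (intro poly_ideal_sum[OF ideal_gap_ideal] poly_ideal_mult[OF ideal_gap_ideal] poly_ring_closed)
  fix t assume t: "t \<in> Poly_Mapping.keys p"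
  then have tc: "Poly_Mapping.keys t \<subseteq> {1..n}" and "\<not> has_gaps 2 (Poly_Mapping.keys t)"
    using p by (auto simp: gap_ideal_def monomial_ideal_def mem_poly_ring)
  then obtain i j where ij: "i \<in> Poly_Mapping.keys t" "j \<in> Poly_Mapping.keys t" "i < j" "j - i < 2"
    by (auto simp: has_gaps_def)
  define s where "s = (\<Sum>i\<in>Poly_Mapping.keys t. Poly_Mapping.single (\<pi> i) (Poly_Mapping.lookup t i))"
  have ks: "\<pi> x \<in> Poly_Mapping.keys s" if "x \<in> Poly_Mapping.keys t" for x
  proof -
    have "0 < Poly_Mapping.lookup (Poly_Mapping.single (\<pi> x) (Poly_Mapping.lookup t x)) (\<pi> x)"
      using that by (simp add: in_keys_iff)
    also have "\<dots> \<le> (\<Sum>i\<in>Poly_Mapping.keys t. Poly_Mapping.lookup (Poly_Mapping.single (\<pi> i) (Poly_Mapping.lookup t i)) (\<pi> x))"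
      using that by (intro member_le_sum) auto
    finally show ?thesis unfolding in_keys_iff s_def lookup_sum by (rule gr_implies_not0)
  qed
  have "Poly_Mapping.keys s \<subseteq> \<pi> ` Poly_Mapping.keys t"
  proof
    fix x assume "x \<in> Poly_Mapping.keys s"
    then have "(\<Sum>i\<in>Poly_Mapping.keys t. Poly_Mapping.lookup (Poly_Mapping.single (\<pi> i) (Poly_Mapping.lookup t i)) x) \<noteq> 0"
      unfolding in_keys_iff s_def lookup_sum .
    then obtain a where a: "a \<in> Poly_Mapping.keys t"
      "Poly_Mapping.lookup (Poly_Mapping.single (\<pi> a) (Poly_Mapping.lookup t a)) x \<noteq> 0"
      by (rule sum.not_neutral_contains_not_neutral)
    then have "x = \<pi> a" by (auto simp: lookup_single when_def split: if_splits)
    then show "x \<in> \<pi> ` Poly_Mapping.keys t" using a(1) by blast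
  qed
  also have "\<dots> \<subseteq> \<pi> ` {1..n}" using tc by blast
  also have "\<dots> \<subseteq> {1..n + r}" using \<pi> by (auto simp: Inc_def)
  finally have sc: "Poly_Mapping.keys s \<subseteq> {1..n + r}" .
  have in1: "i \<in> {1..n}" "j \<in> {1..n}" using ij tc by auto
  have "\<pi> i < \<pi> j" using \<pi> in1 ij(3) strict_mono_onD by (fastforce simp: Inc_def)
  moreover have "\<pi> j - \<pi> i < r + 2" using Inc_spread[OF \<pi> in1(1)] Inc_spread[OF \<pi> in1(2)] ij by linarith
  ultimately have "monomial s \<in> (gap_ideal (n + r) (r + 2) :: 'k mpoly set)"
    using monomial_mem_gap_ideal[OF sc ks[OF ij(1)] ks[OF ij(2)]] by blast
  then show "(\<Prod>i\<in>Poly_Mapping.keys t. mvar (\<pi> i) ^ Poly_Mapping.lookup t i) \<in> (gap_ideal (n + r) (r + 2) :: 'k mpoly set)"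
    by (simp add: monomial_prod s_def)
qed

text \<open>Take a map whose values up to \<open>i\<close> are consecutive integers, and likewise those from \<open>j\<close> on. The
position \<open>k\<close> has to satisfy \<open>k \<le> i\<close> to leave room below \<open>i\<close>, and \<open>j \<le> k + 1 + r\<close> to leave room above \<open>j\<close>;
the least possible value serves.\<close>
lemma Inc_hits_edge:
  assumes "1 \<le> i" "i < j" "j \<le> n + r" "j - i < r + 2" "2 \<le> n"
  obtains \<pi> k where "\<pi> \<in> Inc n (n + r)" "1 \<le> k" "k + 1 \<le> n" "\<pi> k = i" "\<pi> (k + 1) = j"
proof -
  define k where "k = max 1 (j - (r + 1))"
  have k: "1 \<le> k" "k + 1 \<le> n" "k \<le> i" "j \<le> k + 1 + r" using assms by (auto simp: k_def)
  define \<pi> where "\<pi> = restrict (\<lambda>x. if x \<le> k then x + (i - k) else x - (k + 1) + j) {1..n}"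
  have "strict_mono_on {1..n} \<pi>"
    using k assms by (intro strict_mono_onI) (auto simp: \<pi>_def)
  moreover have "\<pi> \<in> {1..n} \<rightarrow>\<^sub>E {1..n + r}" using k assms by (auto simp: \<pi>_def)
  ultimately have "\<pi> \<in> Inc n (n + r)" by (simp add: Inc_def)
  then show ?thesis using k by (intro that[of \<pi> k]) (auto simp: \<pi>_def)
qed

text \<open>By \<open>Inc_spread\<close> the two ends of an edge are moved to vertices that differ by at most \<open>r + 1\<close>,
and by \<open>Inc_hits_edge\<close> every such pair arises.\<close>
lemma Inc_ideal_line_graph:
  assumes n: "2 \<le> n"
  shows "Inc_ideal n (n + r) (edge_ideal n (line_graph n)) = (gap_ideal (n + r) (r + 2) :: 'k::field mpoly set)"
    (is "?L = ?G")
proof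
  let ?gens = "\<Union>\<pi>\<in>Inc n (n + r). induced_hom \<pi> ` (edge_ideal n (line_graph n) :: 'k mpoly set)"
  have sub: "?gens \<subseteq> ?G" using edge_ideal_line_graph_subset induced_hom_mem_gap_ideal by blast
  show "?L \<subseteq> ?G" unfolding Inc_ideal_def by (rule poly_ring.genideal_minimal[OF ideal_gap_ideal sub])
  have gc: "?gens \<subseteq> carrier (poly_ring (n + r))" using sub ideal.Icarr[OF ideal_gap_ideal] by blast
  note L = poly_ring.genideal_ideal[OF gc, folded Inc_ideal_def]
  show "?G \<subseteq> ?L"
  proof
    fix p :: "'k mpoly" assume p: "p \<in> ?G"
    show "p \<in> ?L"
    proof (rule poly_ideal_memI[OF L])
      fix t assume t: "t \<in> Poly_Mapping.keys p"
      then have tc: "Poly_Mapping.keys t \<subseteq> {1..n + r}" and "\<not> has_gaps (r + 2) (Poly_Mapping.keys t)"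
        using p by (auto simp: gap_ideal_def monomial_ideal_def mem_poly_ring)
      then obtain i j where ij: "i \<in> Poly_Mapping.keys t" "j \<in> Poly_Mapping.keys t" "i < j" "j - i < r + 2"
        by (auto simp: has_gaps_def)
      have bounds: "1 \<le> i" "j \<le> n + r" using ij tc by auto
      obtain \<pi> k where \<pi>: "\<pi> \<in> Inc n (n + r)" "1 \<le> k" "k + 1 \<le> n" "\<pi> k = i" "\<pi> (k + 1) = j"
        using Inc_hits_edge[OF bounds(1) ij(3) bounds(2) ij(4) n] .
      let ?E = "{mvar i * mvar j | i j. {i, j} \<in> line_graph n} :: 'k mpoly set"
      have "?E \<subseteq> carrier (poly_ring n)"
      proof clarify
        fix i j assume "{i, j} \<in> line_graph n"
        then have "i \<in> {1..n}" "j \<in> {1..n}" by (auto simp: line_graph_def doubleton_eq_iff)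
        then show "mvar i * mvar j \<in> carrier (poly_ring n :: 'k mpoly ring)" by (intro poly_ring_closed)
      qed
      then have "?E \<subseteq> edge_ideal n (line_graph n)" unfolding edge_ideal_def by (rule poly_ring.genideal_self)
      moreover have "mvar k * mvar (k + 1) \<in> ?E" using \<pi>(2,3) by (auto simp: line_graph_def)
      ultimately have "induced_hom \<pi> (mvar k * mvar (k + 1)) \<in> ?gens" using \<pi>(1) by blast
      then have "induced_hom \<pi> (mvar k * mvar (k + 1)) \<in> ?L"
        unfolding Inc_ideal_def using poly_ring.genideal_self[OF gc] by blast
      moreover have "induced_hom \<pi> (mvar k * mvar (k + 1)) = (mvar i * mvar j :: 'k mpoly)"
        unfolding mvar_mult_mvar[of k] induced_hom_def
        using \<pi>(4,5) by (simp add: keys_add_nat lookup_add lookup_single mconst_def)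
      ultimately have ij_mem: "(mvar i * mvar j :: 'k mpoly) \<in> ?L" by simp
      define s where "s = Poly_Mapping.single i 1 + Poly_Mapping.single j (1::nat)"
      have ts: "t = (t - s) + s"
        using ij by (intro poly_mapping_eqI)
          (auto simp: s_def lookup_add lookup_minus lookup_single when_def in_keys_iff)
      have "Poly_Mapping.keys (t - s) \<subseteq> {1..n + r}" using tc by (auto simp: in_keys_iff lookup_minus)
      then have "monomial (t - s) * (mvar i * mvar j) \<in> ?L"
        by (intro poly_ideal_mult[OF L ij_mem] poly_ring_closed)
      then show "monomial t \<in> ?L"
        unfolding mvar_mult_mvar mult_single s_def[symmetric] using ts by simp
    qed
  qed
qed

section \<open>Dimension, depth and maximal faces\<close>

lemma krull_dim_gap_ideal_ge:
  assumes "F \<subseteq> {1..m}" "has_gaps d F"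
  shows "enat (card F) \<le> krull_dim (poly_ring m Quot (gap_ideal m d :: 'k::field mpoly set))"
proof (rule krull_dim_quot_ge[OF ideal_gap_ideal assms(1)])
  show "gap_ideal m d \<subseteq> (off_face_ideal m F :: 'k mpoly set)"
    using has_gaps_mono[OF _ assms(2)] by (auto simp: gap_ideal_def off_face_ideal_def monomial_ideal_def)
qed

lemma krull_dim_gap_ideal_le:
  assumes "\<And>F. F \<subseteq> {1..m} \<Longrightarrow> has_gaps d F \<Longrightarrow> card F \<le> k"
  shows "krull_dim (poly_ring m Quot (gap_ideal m d :: 'k::field mpoly set)) \<le> enat k"
proof (rule krull_dim_quot_le[OF ideal_gap_ideal])
  show "finite {F. F \<subseteq> {1..m} \<and> has_gaps d F}" by (rule finite_subset[of _ "Pow {1..m}"]) auto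
  show "F \<subseteq> {1..m} \<and> card F \<le> k" if "F \<in> {F. F \<subseteq> {1..m} \<and> has_gaps d F}" for F
    using that assms by auto
  fix w :: "'k mpoly"
  assume w: "w \<in> carrier (poly_ring m)" "\<forall>F\<in>{F. F \<subseteq> {1..m} \<and> has_gaps d F}. w \<in> off_face_ideal m F"
  have "\<not> has_gaps d (Poly_Mapping.keys t)" if t: "t \<in> Poly_Mapping.keys w" for t
  proof
    assume "has_gaps d (Poly_Mapping.keys t)"
    moreover have "Poly_Mapping.keys t \<subseteq> {1..m}" using w(1) t by (simp add: mem_poly_ring)
    ultimately have "w \<in> off_face_ideal m (Poly_Mapping.keys t)" using w(2) by blast
    then show False using t by (auto simp: off_face_ideal_def monomial_ideal_def)
  qed
  then show "w \<in> gap_ideal m d" using w(1) by (simp add: gap_ideal_def monomial_ideal_def)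
qed

text \<open>By maximality each variable outside \<open>F\<close> kills the product of the variables in \<open>F\<close> modulo the
ideal, so this product has the prime of \<open>F\<close> as its annihilator.\<close>
lemma depth_gap_ideal_le:
  assumes F: "F \<subseteq> {1..m}" "has_gaps d F"
    and max: "\<And>x. x \<in> {1..m} \<Longrightarrow> x \<notin> F \<Longrightarrow> \<not> has_gaps d (insert x F)"
  shows "depth (poly_ring m Quot (gap_ideal m d :: 'k::field mpoly set))
    ((\<lambda>f. gap_ideal m d +>\<^bsub>poly_ring m\<^esub> f) ` irrelevant_ideal m) \<le> enat (card F)"
proof -
  define t where "t = (\<Sum>i\<in>F. Poly_Mapping.single i (1::nat))"
  have finF: "finite F" using F(1) finite_subset by blast
  have "Poly_Mapping.lookup t i = (if i \<in> F then 1 else 0)" for i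
    using finF by (simp add: t_def lookup_sum lookup_single when_def)
  then have kt: "Poly_Mapping.keys t = F" by (auto simp: in_keys_iff split: if_splits)
  show ?thesis
  proof (rule depth_quot_le[OF ideal_gap_ideal F(1)])
    show "gap_ideal m d \<subseteq> (off_face_ideal m F :: 'k mpoly set)"
      using has_gaps_mono[OF _ F(2)] by (auto simp: gap_ideal_def off_face_ideal_def monomial_ideal_def)
    show "monomial t \<in> carrier (poly_ring m :: 'k mpoly ring)" using kt F(1) by (intro poly_ring_closed) simp
    show "monomial t \<notin> (off_face_ideal m F :: 'k mpoly set)"
      by (simp add: off_face_ideal_def monomial_ideal_def kt)
    fix g :: "'k mpoly" assume g: "g \<in> off_face_ideal m F"
    then have gc: "g \<in> carrier (poly_ring m)" by (simp add: off_face_ideal_def monomial_ideal_def)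
    have "\<not> has_gaps d (Poly_Mapping.keys s)" if "s \<in> Poly_Mapping.keys (g * monomial t)" for s
    proof -
      obtain v where v: "v \<in> Poly_Mapping.keys g" "s = v + t"
        using \<open>s \<in> _\<close> by (auto elim!: keys_mult_cases)
      have "\<not> Poly_Mapping.keys v \<subseteq> F" "Poly_Mapping.keys v \<subseteq> {1..m}"
        using g v(1) by (auto simp: off_face_ideal_def monomial_ideal_def mem_poly_ring)
      then obtain x where x: "x \<in> Poly_Mapping.keys v" "x \<in> {1..m}" "x \<notin> F" by blast
      have "insert x F \<subseteq> Poly_Mapping.keys s" using x(1) kt by (auto simp: v(2) keys_add_nat)
      then show ?thesis using max[OF x(2,3)] has_gaps_mono by blast
    qed
    moreover have "g * monomial t \<in> carrier (poly_ring m)"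
      using kt F(1) by (intro poly_ring_closed gc) simp
    ultimately show "g * monomial t \<in> gap_ideal m d" by (simp add: gap_ideal_def monomial_ideal_def)
  qed
qed

lemma has_gaps_progression: "has_gaps d ((\<lambda>j. c + j * d) ` A)"
proof (unfold has_gaps_def, intro ballI impI)
  fix x y assume "x \<in> (\<lambda>j. c + j * d) ` A" "y \<in> (\<lambda>j. c + j * d) ` A" and xy: "x < y"
  then obtain i j where ij: "x = c + i * d" "y = c + j * d" by auto
  then have "i < j" using xy by (metis add_less_cancel_left mult_less_cancel2)
  then have "Suc i * d \<le> j * d" by (intro mult_le_mono1) simp
  then show "d \<le> y - x" by (simp add: ij)
qed

text \<open>The face \<open>G\<close> consists of elements \<open>1, d + 1, 2 d + 1, \<dots>\<close> packed as tightly as possible. The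
maximal face \<open>F\<close> starts at \<open>d\<close>, the largest possible first element, which alone excludes everything
up to \<open>2 d - 1\<close>. If \<open>m < 2 d\<close>, then \<open>F = {d}\<close> is already maximal while \<open>{1, d + 1}\<close> is a face. If
\<open>m > 2 d\<close>, the next element \<open>b\<close> of \<open>F\<close> is as large as maximality permits, thus at least \<open>2 d + 1\<close>, and
from there \<open>F\<close> proceeds in steps of \<open>d\<close>. Each \<open>b + j d\<close> in \<open>F\<close> is then matched by \<open>1 + (j + 2) d\<close> in \<open>G\<close>,
and \<open>d\<close> by \<open>1\<close>, which leaves \<open>d + 1\<close> over.\<close>
lemma two_maximal_sizes:
  assumes d: "2 \<le> d" and m: "d < m" "m \<noteq> 2 * d"
  shows "\<exists>F G. F \<subseteq> {1..m} \<and> has_gaps d F \<and> (\<forall>x\<in>{1..m}. x \<notin> F \<longrightarrow> \<not> has_gaps d (insert x F)) \<and>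
    G \<subseteq> {1..m} \<and> has_gaps d G \<and> card F < card G"
proof -
  define b where "b = min (3 * d - 1) m"
  define A where "A = (if m < 2 * d then {} else {j. b + j * d \<le> m})"
  define F where "F = insert d ((\<lambda>j. b + j * d) ` A)"
  define A' where "A' = insert 0 (insert 1 ((\<lambda>j. j + 2) ` A))"
  define G where "G = (\<lambda>j. 1 + j * d) ` A'"
  have b: "2 * d + 1 \<le> b" "b \<le> 3 * d - 1" "b \<le> m" if "\<not> m < 2 * d"
    using that m d by (auto simp: b_def)
  have A: "\<not> m < 2 * d" "b + j * d \<le> m" if "j \<in> A" for j
    using that by (auto simp: A_def split: if_splits)
  have finA: "finite A"
  proof (rule finite_subset)
    show "A \<subseteq> {..m}"
    proof
      fix j assume "j \<in> A"
      then have "j * d \<le> m" using A(2)[of j] by simp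
      moreover have "j * 1 \<le> j * d" using d by (intro mult_le_mono2) simp
      ultimately show "j \<in> {..m}" unfolding mult_1_right atMost_iff by linarith
    qed
  qed simp
  have inj: "inj_on (\<lambda>j. c + j * d) X" for c X using d by (auto simp: inj_on_def)
  have "F \<subseteq> {1..m}" using d m A(2) b A(1) by (fastforce simp: F_def)
  moreover have "has_gaps d F"
  proof (unfold has_gaps_def, intro ballI impI)
    fix x y assume x: "x \<in> F" and y: "y \<in> F" and xy: "x < y"
    have ge: "2 * d \<le> z" if "z \<in> F" "z \<noteq> d" for z
      using that A(1) b(1) by (auto simp: F_def intro: trans_le_add1)
    show "d \<le> y - x"
    proof (cases "x = d \<or> y = d")
      case True
      then show ?thesis using ge[OF x] ge[OF y] xy d by auto
    next
      case False
      then have "x \<in> (\<lambda>j. b + j * d) ` A" "y \<in> (\<lambda>j. b + j * d) ` A" using x y by (auto simp: F_def)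
      then show ?thesis using has_gaps_progression[of d b A] xy by (auto simp: has_gaps_def)
    qed
  qed
  moreover have "\<not> has_gaps d (insert x F)" if x: "x \<in> {1..m}" "x \<notin> F" for x
  proof -
    have near: "\<not> has_gaps d (insert x F)" if "y \<in> F" "x < y + d" "y < x + d" for y
    proof -
      have "x \<noteq> y" using that x by auto
      then have "(x < y \<and> y - x < d) \<or> (y < x \<and> x - y < d)" using that by auto
      then show ?thesis using that(1) unfolding has_gaps_def by (meson insertCI not_le)
    qed
    show ?thesis
    proof (cases "x < 2 * d")
      case True
      then show ?thesis using x(1) by (intro near[of d]) (auto simp: F_def)
    next
      case False
      then have m2: "\<not> m < 2 * d" using x(1) by auto
      show ?thesis
      proof (cases "x < b")
        case True
        have "0 \<in> A" using b(3)[OF m2] m2 by (simp add: A_def)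
        then have "b \<in> F" unfolding F_def by force
        then show ?thesis using True False b(2)[OF m2] d by (intro near[of b]) auto
      next
        case xb: False
        define j where "j = (x - b) div d"
        have xj: "x = b + j * d + (x - b) mod d" using xb by (simp add: j_def)
        have "(x - b) mod d < d" using d by simp
        moreover have "b + j * d \<in> F" using m2 x(1) xj by (auto simp: A_def F_def)
        ultimately show ?thesis using xj by (intro near[of "b + j * d"]) linarith+
      qed
    qed
  qed
  moreover have "G \<subseteq> {1..m}"
  proof -
    have "1 + (j + 2) * d \<le> m" if "j \<in> A" for j
      using A[OF that] b(1) by (simp add: algebra_simps)
    then show ?thesis using m d by (auto simp: G_def A'_def)
  qed
  moreover have "has_gaps d G" unfolding G_def by (rule has_gaps_progression)
  moreover have "card F < card G"
  proof -
    have "card F \<le> Suc (card ((\<lambda>j. b + j * d) ` A))" unfolding F_def by (rule card_insert_le_m1 card_insert_le | simp add: card_insert_if finA)+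
    also have "card ((\<lambda>j. b + j * d) ` A) = card A" by (rule card_image[OF inj])
    also have "Suc (card A) < card A'"
      using finA by (simp add: A'_def card_insert_if card_image inj_on_def image_iff)
    also have "card A' = card G" unfolding G_def by (rule card_image[OF inj, symmetric])
    finally show ?thesis .
  qed
  ultimately show ?thesis by blast
qed

text \<open>Each of the two blocks \<open>{1..d}\<close> and \<open>{d + 1..2 d}\<close> contains at most one element of \<open>F\<close>.\<close>
lemma card_has_gaps_le_2:
  assumes "F \<subseteq> {1..2 * d}" "has_gaps d F"
  shows "card F \<le> 2"
proof -
  have inj: "inj_on (\<lambda>x. (x - 1) div d) F"
  proof (rule inj_onI)
    have *: "\<not> x < y" if x: "x \<in> F" and y: "y \<in> F" and eq: "(x - 1) div d = (y - 1) div d" for x y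
    proof
      assume xy: "x < y"
      have "d \<le> y - x" using assms(2) x y xy by (auto simp: has_gaps_def)
      moreover have "1 \<le> x" using x assms(1) by auto
      ultimately have "x - 1 + d \<le> y - 1" using xy by linarith
      then have "(x - 1 + d) div d \<le> (y - 1) div d" by (rule div_le_mono)
      moreover have "0 < d" using x assms(1) by (cases d) auto
      ultimately show False using eq by simp
    qed
    fix x y assume "x \<in> F" "y \<in> F" "(x - 1) div d = (y - 1) div d"
    then show "x = y" using *[of x y] *[of y x] by auto
  qed
  have "(\<lambda>x. (x - 1) div d) ` F \<subseteq> {..<2}"
  proof (rule image_subsetI)
    fix x assume "x \<in> F"
    then have "x \<in> {1..2 * d}" using assms(1) by blast
    then have "x - 1 < 2 * d" by auto
    then show "(x - 1) div d \<in> {..<2}" by (simp add: less_mult_imp_div_less)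
  qed
  from card_inj_on_le[OF inj this] show ?thesis by simp
qed

section \<open>A regular sequence of length two\<close>

definition var_sum :: "nat set \<Rightarrow> 'k::field mpoly"
  where "var_sum A = (\<Sum>a\<in>A. mvar a)"

lemma lookup_mvar_mult:
  "Poly_Mapping.lookup (mvar a * p) t =
    (if a \<in> Poly_Mapping.keys t then Poly_Mapping.lookup (p :: 'k::field mpoly) (t - Poly_Mapping.single a 1) else 0)"
proof (cases "a \<in> Poly_Mapping.keys t")
  case True
  then have "t = Poly_Mapping.single a 1 + (t - Poly_Mapping.single a 1)"
    by (intro poly_mapping_eqI) (auto simp: lookup_add lookup_minus lookup_single when_def in_keys_iff)
  then have "Poly_Mapping.lookup (mvar a * p) t = Poly_Mapping.lookup p (t - Poly_Mapping.single a 1)"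
    unfolding mvar_def by (metis lookup_single_mult_add mult_1)
  then show ?thesis using True by simp
next
  case False
  then have "t \<notin> Poly_Mapping.keys (mvar a * p)"
    by (auto simp: mvar_def keys_add_nat elim!: keys_mult_cases)
  then show ?thesis using False by (simp add: in_keys_iff)
qed

lemma lookup_var_sum_mult_disjoint:
  assumes "Poly_Mapping.keys t \<inter> A = {}"
  shows "Poly_Mapping.lookup (var_sum A * p) t = 0"
  using assms by (auto simp: var_sum_def sum_distrib_right lookup_sum lookup_mvar_mult intro!: sum.neutral)

text \<open>On a clique \<open>A\<close>, a monomial supported on a face involves at most one variable from \<open>A\<close>, so only
one summand of \<open>var_sum A\<close> contributes to its coefficient. This is why the sum over a clique
behaves like a single variable modulo the ideal.\<close>
lemma lookup_var_sum_mult: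
  assumes "finite A" "a \<in> A" and clique: "\<And>x y. x \<in> A \<Longrightarrow> y \<in> A \<Longrightarrow> x < y \<Longrightarrow> y - x < d"
    and "has_gaps d (Poly_Mapping.keys (t + Poly_Mapping.single a 1))"
  shows "Poly_Mapping.lookup (var_sum A * p) (t + Poly_Mapping.single a 1) = Poly_Mapping.lookup (p :: 'k::field mpoly) t"
proof -
  let ?t = "t + Poly_Mapping.single a 1"
  have "x \<notin> Poly_Mapping.keys ?t" if "x \<in> A" "x \<noteq> a" for x
  proof
    assume "x \<in> Poly_Mapping.keys ?t"
    moreover have "a \<in> Poly_Mapping.keys ?t" by (simp add: keys_add_nat)
    ultimately have "x < a \<Longrightarrow> d \<le> a - x" "a < x \<Longrightarrow> d \<le> x - a"
      using assms(4) by (auto simp: has_gaps_def)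
    then show False using clique[OF that(1) assms(2)] clique[OF assms(2) that(1)] that(2) by linarith
  qed
  then have "(\<Sum>x\<in>A. Poly_Mapping.lookup (mvar x * p) ?t) = (\<Sum>x\<in>A. if x = a then Poly_Mapping.lookup p t else 0)"
    by (intro sum.cong) (auto simp: lookup_mvar_mult keys_add_nat)
  then show ?thesis using assms(1,2) by (simp add: var_sum_def sum_distrib_right lookup_sum)
qed


text \<open>The sequence consists of the sum \<open>y\<close> of the variables over \<open>A = {1..d}\<close> and the sum \<open>z\<close> over
\<open>B = {d + 1..2 d}\<close>, both cliques. A face contains at most one vertex of either, and both \<open>1\<close> and \<open>2 d\<close>
form a face with every vertex of the other clique; these two facts determine all coefficients
involved.

If \<open>y p\<close> vanishes on faces, so does \<open>p\<close>, because every face monomial \<open>t\<close> can be multiplied by a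
variable from \<open>A\<close> without leaving the faces, and \<open>p\<close> has at \<open>t\<close> the same coefficient as \<open>y p\<close> at this
multiple. If \<open>z p \<equiv> y q\<close>, then \<open>p\<close> vanishes on face monomials without variables from \<open>A\<close>, since \<open>y q\<close>
does. On the others divide by a variable from \<open>A\<close>: the coefficients of \<open>w\<close> with \<open>p \<equiv> y w\<close> are read off
from \<open>p\<close>. The choice of the variable matters only for monomials \<open>s\<close> over \<open>B\<close>, and there the relation
identifies the coefficient of \<open>p\<close> at \<open>s x\<^sub>c\<close> with the one of \<open>q\<close> at \<open>s x\<^sub>b\<close>, for each admissible \<open>c\<close>.\<close>
lemma depth_gap_ideal_ge_2:
  assumes d: "1 \<le> d"
  defines "I \<equiv> gap_ideal (2 * d) d :: 'k::field mpoly set"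
  shows "2 \<le> depth (poly_ring (2 * d) Quot I) ((\<lambda>f. I +>\<^bsub>poly_ring (2 * d)\<^esub> f) ` irrelevant_ideal (2 * d))"
proof -
  define m where "m = 2 * d"
  define A where "A = {1..d}"
  define B where "B = {d + 1..m}"
  let ?R = "poly_ring m :: 'k mpoly ring"
  let ?y = "var_sum A :: 'k mpoly" and ?z = "var_sum B :: 'k mpoly"
  have I: "ideal I ?R" unfolding I_def m_def by (rule ideal_gap_ideal)
  have memI: "p \<in> I \<longleftrightarrow> p \<in> carrier ?R \<and>
      (\<forall>t. has_gaps d (Poly_Mapping.keys t) \<longrightarrow> Poly_Mapping.lookup p t = 0)" for p
    unfolding I_def m_def by (rule mem_gap_ideal)
  have lookup_eq: "Poly_Mapping.lookup p t = Poly_Mapping.lookup q t"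
    if "p - q \<in> I" "has_gaps d (Poly_Mapping.keys t)" for p q t
    using that by (simp add: memI lookup_minus)
  have AB: "A \<union> B = {1..m}" "A \<inter> B = {}" "finite A" "finite B" "1 \<in> A" "m \<in> B"
    using d by (auto simp: A_def B_def m_def)
  have yc: "?y \<in> carrier ?R" unfolding var_sum_def
    by (intro poly_ring_sum mvar_mem_poly_ring) (use AB in blast)
  have zc: "?z \<in> carrier ?R" unfolding var_sum_def
    by (intro poly_ring_sum mvar_mem_poly_ring) (use AB in blast)
  have cliqueA: "y - x < d" if "x \<in> A" "y \<in> A" "x < y" for x y using that by (auto simp: A_def)
  have cliqueB: "y - x < d" if "x \<in> B" "y \<in> B" "x < y" for x y using that by (auto simp: B_def m_def)
  have yA: "Poly_Mapping.lookup (?y * p) (t + Poly_Mapping.single a 1) = Poly_Mapping.lookup p t"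
    if "a \<in> A" "has_gaps d (Poly_Mapping.keys (t + Poly_Mapping.single a 1))" for a p t
    using lookup_var_sum_mult[OF AB(3) that(1) _ that(2)] cliqueA by blast
  have zB: "Poly_Mapping.lookup (?z * p) (t + Poly_Mapping.single a 1) = Poly_Mapping.lookup p t"
    if "a \<in> B" "has_gaps d (Poly_Mapping.keys (t + Poly_Mapping.single a 1))" for a p t
    using lookup_var_sum_mult[OF AB(4) that(1) _ that(2)] cliqueB by blast
  have uniqueA: "x = y" if "has_gaps d F" "x \<in> F" "y \<in> F" "x \<in> A" "y \<in> A" for x y F
  proof (rule ccontr)
    assume "x \<noteq> y"
    then consider "x < y" | "y < x" by linarith
    then show False
    proof cases
      case 1
      then have "d \<le> y - x" using that(1-3) unfolding has_gaps_def by blast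
      then show False using cliqueA[OF that(4,5) 1] by simp
    next
      case 2
      then have "d \<le> x - y" using that(1-3) unfolding has_gaps_def by blast
      then show False using cliqueA[OF that(5,4) 2] by simp
    qed
  qed
  have uniqueB: "x = y" if "has_gaps d F" "x \<in> F" "y \<in> F" "x \<in> B" "y \<in> B" for x y F
  proof (rule ccontr)
    assume "x \<noteq> y"
    then consider "x < y" | "y < x" by linarith
    then show False
    proof cases
      case 1
      then have "d \<le> y - x" using that(1-3) unfolding has_gaps_def by blast
      then show False using cliqueB[OF that(4,5) 1] by simp
    next
      case 2
      then have "d \<le> x - y" using that(1-3) unfolding has_gaps_def by blast
      then show False using cliqueB[OF that(5,4) 2] by simp
    qed
  qed
  have single_gaps: "has_gaps d F" if "F \<subseteq> {x}" for F x
    using that unfolding has_gaps_def by blast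
  have pair_gaps: "has_gaps d F" if "F \<subseteq> {a, b}" "a + d \<le> b" for F a b
  proof (unfold has_gaps_def, intro ballI impI)
    fix i j assume "i \<in> F" "j \<in> F" "i < j"
    then have "i \<in> {a, b}" "j \<in> {a, b}" using that(1) by blast+
    then show "d \<le> j - i" using \<open>i < j\<close> that(2) by auto
  qed
  \<comment> \<open>For a face monomial over \<open>B\<close> the vertex \<open>b\<close> is the one it involves; for the monomial \<open>1\<close> it is
  \<open>m\<close>, which forms a face with every vertex of \<open>A\<close>.\<close>
  have partner: "\<exists>b\<in>B. Poly_Mapping.keys t \<subseteq> {b} \<and> (b \<in> Poly_Mapping.keys t \<or> b = m)"
    if "Poly_Mapping.keys t \<subseteq> {1..m}" "has_gaps d (Poly_Mapping.keys t)" "Poly_Mapping.keys t \<inter> A = {}" for t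
  proof (cases "Poly_Mapping.keys t = {}")
    case True
    then show ?thesis using AB(6) by blast
  next
    case False
    then obtain b where b: "b \<in> Poly_Mapping.keys t" by blast
    have "Poly_Mapping.keys t \<subseteq> B" using that(1,3) AB(1) by blast
    then have "Poly_Mapping.keys t \<subseteq> {b}" "b \<in> B" using uniqueB[OF that(2) _ b] b by blast+
    then show ?thesis using b by blast
  qed

  have y_regular: "p \<in> I" if p: "p \<in> carrier ?R" and yp: "?y * p \<in> I" for p
  proof -
    have "Poly_Mapping.lookup p t = 0" if g: "has_gaps d (Poly_Mapping.keys t)" for t
    proof (cases "Poly_Mapping.keys t \<subseteq> {1..m}")
      case False
      then show ?thesis using p by (auto simp: mem_poly_ring in_keys_iff)
    next
      case tm: True
      have "\<exists>a\<in>A. has_gaps d (insert a (Poly_Mapping.keys t))"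
      proof (cases "Poly_Mapping.keys t \<inter> A = {}")
        case True
        then obtain b where b: "b \<in> B" "Poly_Mapping.keys t \<subseteq> {b}" using partner[OF tm g] by blast
        then show ?thesis using AB(5) by (intro bexI[of _ 1] pair_gaps[of _ 1 b]) (auto simp: B_def)
      next
        case False
        then obtain a where "a \<in> Poly_Mapping.keys t" "a \<in> A" by blast
        then show ?thesis using g by (intro bexI[of _ a]) (auto simp: insert_absorb)
      qed
      then obtain a where a: "a \<in> A" "has_gaps d (Poly_Mapping.keys (t + Poly_Mapping.single a 1))"
        by (auto simp: keys_add_nat)
      then show ?thesis using yA[OF a(1) a(2), of p] yp a(2) by (simp add: memI)
    qed
    then show ?thesis using p by (simp add: memI)
  qed

  define J where "J = Idl\<^bsub>?R\<^esub> (insert ?y I)"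
  have memJ: "p \<in> J \<longleftrightarrow> (\<exists>j\<in>I. \<exists>w\<in>carrier ?R. p = j + ?y * w)" for p
    unfolding J_def using poly_ring.mem_genideal_insert[OF I yc, of p] by (simp add: poly_ring_sel)

  have z_regular: "p \<in> J" if p: "p \<in> carrier ?R" and zp: "?z * p \<in> J" for p
  proof -
    obtain j q where jq: "j \<in> I" "q \<in> carrier ?R" "?z * p = j + ?y * q" using zp unfolding memJ by blast
    then have "?z * p - ?y * q \<in> I" by simp
    note zy = lookup_eq[OF this]
    \<comment> \<open>The variable from \<open>A\<close> by which \<open>w\<close> is shifted at the monomial \<open>s\<close>: the one occurring in \<open>s\<close>, and
    otherwise \<open>x\<^sub>1\<close>, which is compatible with every vertex of \<open>B\<close>.\<close>
    define \<alpha> where "\<alpha> s = (if Poly_Mapping.keys s \<inter> A = {} then 1 else (SOME a. a \<in> Poly_Mapping.keys s \<inter> A))"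
      for s :: "nat \<Rightarrow>\<^sub>0 nat"
    have \<alpha>: "\<alpha> s \<in> A" "Poly_Mapping.keys s \<inter> A \<noteq> {} \<Longrightarrow> \<alpha> s \<in> Poly_Mapping.keys s" for s
      using AB(5) someI_ex[of "\<lambda>a. a \<in> Poly_Mapping.keys s \<inter> A"] by (auto simp: \<alpha>_def)
    \<comment> \<open>A finite set that contains all \<open>s\<close> with a nonzero coefficient in \<open>w\<close>.\<close>
    define T where "T = (\<Union>a\<in>A. (\<lambda>t. t - Poly_Mapping.single a 1) ` Poly_Mapping.keys p)"
    define w where "w = (\<Sum>s\<in>T. Poly_Mapping.single s (Poly_Mapping.lookup p (s + Poly_Mapping.single (\<alpha> s) 1)))"
    have finT: "finite T" using AB(3) by (simp add: T_def)
    have lw: "Poly_Mapping.lookup w s = Poly_Mapping.lookup p (s + Poly_Mapping.single (\<alpha> s) 1)" for s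
    proof (cases "s \<in> T")
      case True
      then show ?thesis using finT by (simp add: w_def lookup_sum lookup_single when_def)
    next
      case False
      have "s + Poly_Mapping.single (\<alpha> s) 1 \<notin> Poly_Mapping.keys p"
      proof
        assume "s + Poly_Mapping.single (\<alpha> s) 1 \<in> Poly_Mapping.keys p"
        then have "(s + Poly_Mapping.single (\<alpha> s) 1) - Poly_Mapping.single (\<alpha> s) 1 \<in> T"
          unfolding T_def using \<alpha>(1) by blast
        then show False using False by simp
      qed
      then show ?thesis using finT False by (simp add: w_def lookup_sum lookup_single when_def in_keys_iff)
    qed
    have wc: "w \<in> carrier ?R"
    proof (unfold mem_poly_ring, intro ballI)
      fix s assume "s \<in> Poly_Mapping.keys w"
      then have "s + Poly_Mapping.single (\<alpha> s) 1 \<in> Poly_Mapping.keys p" by (simp add: in_keys_iff lw)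
      then have "Poly_Mapping.keys (s + Poly_Mapping.single (\<alpha> s) 1) \<subseteq> {1..m}" using p unfolding mem_poly_ring by blast
      then show "Poly_Mapping.keys s \<subseteq> {1..m}" by (simp add: keys_add_nat)
    qed
    have "Poly_Mapping.lookup (?y * w) t = Poly_Mapping.lookup p t"
      if g: "has_gaps d (Poly_Mapping.keys t)" and tm: "Poly_Mapping.keys t \<subseteq> {1..m}" for t
    proof (cases "Poly_Mapping.keys t \<inter> A = {}")
      case True
      obtain b where b: "b \<in> B" "Poly_Mapping.keys t \<subseteq> {b}" using partner[OF tm g True] by blast
      let ?t = "t + Poly_Mapping.single b 1"
      have kt: "Poly_Mapping.keys ?t \<subseteq> {b}" using b(2) by (simp add: keys_add_nat)
      note gt = single_gaps[OF kt]
      have "Poly_Mapping.lookup p t = Poly_Mapping.lookup (?z * p) ?t"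
        using zB[OF b(1) gt, of p] by simp
      also have "\<dots> = Poly_Mapping.lookup (?y * q) ?t" by (rule zy[OF gt])
      also have "\<dots> = 0" using kt b(1) AB(2) by (intro lookup_var_sum_mult_disjoint) blast
      finally show ?thesis using lookup_var_sum_mult_disjoint[OF True] by simp
    next
      case False
      then obtain a where a: "a \<in> Poly_Mapping.keys t" "a \<in> A" by blast
      define s where "s = t - Poly_Mapping.single a 1"
      have ts: "t = s + Poly_Mapping.single a 1"
        using a(1) by (intro poly_mapping_eqI)
          (auto simp: s_def lookup_add lookup_minus lookup_single when_def in_keys_iff)
      have ks: "Poly_Mapping.keys s \<subseteq> Poly_Mapping.keys t" by (auto simp: ts keys_add_nat)
      have "Poly_Mapping.lookup (?y * w) t = Poly_Mapping.lookup w s"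
        using yA[OF a(2) g[unfolded ts], of w] unfolding ts[symmetric] by simp
      also have "\<dots> = Poly_Mapping.lookup p (s + Poly_Mapping.single (\<alpha> s) 1)" by (rule lw)
      also have "\<dots> = Poly_Mapping.lookup p (s + Poly_Mapping.single a 1)"
      proof (cases "Poly_Mapping.keys s \<inter> A = {}")
        case False
        then have "\<alpha> s = a" using uniqueA[OF g _ a(1) \<alpha>(1) a(2)] \<alpha>(2) ks by blast
        then show ?thesis by simp
      next
        case sA: True
        have gs: "has_gaps d (Poly_Mapping.keys s)" using g ks has_gaps_mono by blast
        obtain b where b: "b \<in> B" "Poly_Mapping.keys s \<subseteq> {b}" "b \<in> Poly_Mapping.keys s \<or> b = m"
          using partner[OF _ gs sA] ks tm by blast
        have coeff: "Poly_Mapping.lookup p (s + Poly_Mapping.single c 1) =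
            Poly_Mapping.lookup q (s + Poly_Mapping.single b 1)" if c: "c \<in> A" "c + d \<le> b" for c
        proof -
          let ?t = "s + Poly_Mapping.single c 1 + Poly_Mapping.single b 1"
          have t': "?t = s + Poly_Mapping.single b 1 + Poly_Mapping.single c 1" by (simp add: add_ac)
          have gt: "has_gaps d (Poly_Mapping.keys ?t)"
            by (rule pair_gaps[OF _ c(2)]) (use b(2) in \<open>auto simp: keys_add_nat\<close>)
          have "Poly_Mapping.lookup p (s + Poly_Mapping.single c 1) = Poly_Mapping.lookup (?z * p) ?t"
            using zB[OF b(1) gt, of p] by simp
          also have "\<dots> = Poly_Mapping.lookup (?y * q) ?t" by (rule zy[OF gt])
          also have "\<dots> = Poly_Mapping.lookup q (s + Poly_Mapping.single b 1)"
            using yA[OF c(1) gt[unfolded t'], of q] unfolding t' by simp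
          finally show ?thesis .
        qed
        have "1 + d \<le> b" using b(1) by (simp add: B_def)
        moreover have "a + d \<le> b"
          using b(3)
        proof
          assume "b \<in> Poly_Mapping.keys s"
          then have "b \<in> Poly_Mapping.keys t" using ks by blast
          moreover have "a < b" using a(2) b(1) by (auto simp: A_def B_def)
          ultimately show ?thesis using g a(1) by (fastforce simp: has_gaps_def)
        qed (use a(2) in \<open>simp add: A_def m_def\<close>)
        ultimately show ?thesis using coeff[OF AB(5)] coeff[OF a(2)] sA by (simp add: \<alpha>_def)
      qed
      finally show ?thesis by (simp add: ts)
    qed
    moreover have "Poly_Mapping.lookup (?y * w) t = 0 \<and> Poly_Mapping.lookup p t = 0"
      if "\<not> Poly_Mapping.keys t \<subseteq> {1..m}" for t
      using that p poly_ring_closed(1)[OF yc wc] by (auto simp: mem_poly_ring in_keys_iff)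
    ultimately have "p - ?y * w \<in> I"
      using poly_ring_closed(3)[OF p poly_ring_closed(1)[OF yc wc]]
      unfolding memI by (metis lookup_minus cancel_comm_monoid_add_class.diff_cancel)
    then show ?thesis unfolding memJ using wc by (intro bexI[of _ "p - ?y * w"] bexI[of _ w]) simp_all
  qed

  let ?S = "?R Quot I" and ?\<pi> = "(+>\<^bsub>?R\<^esub>) I"
  have Iirr: "I \<subseteq> irrelevant_ideal m"
    unfolding I_def m_def irrelevant_ideal_eq gap_ideal_def off_face_ideal_def monomial_ideal_def
    by (auto simp: has_gaps_def)
  note irr = primeideal.axioms(1)[OF primeideal_irrelevant]
  have var_irr: "var_sum X \<in> irrelevant_ideal m" if X: "X \<subseteq> {1..m}" for X
    unfolding var_sum_def
  proof (rule poly_ideal_sum[OF irr])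
    have "mvar ` {1..m} \<subseteq> irrelevant_ideal m"
      unfolding irrelevant_ideal_def
      by (intro poly_ring.genideal_self image_subsetI mvar_mem_poly_ring)
    then show "mvar x \<in> irrelevant_ideal m" if "x \<in> X" for x using that X by blast
  qed
  have yi: "?y \<in> irrelevant_ideal m" and zi: "?z \<in> irrelevant_ideal m"
    using var_irr[of A] var_irr[of B] AB(1) by auto
  have "regular_sequence ?S [?\<pi> ?y, ?\<pi> ?z]"
    unfolding regular_sequence_def
  proof (intro conjI allI impI ballI)
    show "set [?\<pi> ?y, ?\<pi> ?z] \<subseteq> carrier ?S" using yc zc unfolding poly_ring.carrier_quot by simp
    show "a \<in> Idl\<^bsub>?S\<^esub> (set (take i [?\<pi> ?y, ?\<pi> ?z]))"
      if i: "i < length [?\<pi> ?y, ?\<pi> ?z]" and a: "a \<in> carrier ?S"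
        and *: "[?\<pi> ?y, ?\<pi> ?z] ! i \<otimes>\<^bsub>?S\<^esub> a \<in> Idl\<^bsub>?S\<^esub> (set (take i [?\<pi> ?y, ?\<pi> ?z]))" for i a
    proof -
      obtain p where p: "p \<in> carrier ?R" "a = ?\<pi> p" using a unfolding poly_ring.carrier_quot by blast
      have yp: "?y * p \<in> carrier ?R" and zp: "?z * p \<in> carrier ?R" using yc zc p(1) by (simp_all add: poly_ring_closed)
      have I0: "Idl\<^bsub>?R\<^esub> (I \<union> {}) = I"
        using poly_ring.genideal_minimal[OF I, of I] poly_ring.genideal_self[of I m] poly_ideal_carrier[OF I] by auto
      consider "i = 0" | "i = 1" using i by fastforce
      then show ?thesis
      proof cases
        case 1
        have "?\<pi> (?y * p) \<in> Idl\<^bsub>?S\<^esub> (?\<pi> ` {})"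
          using * 1 p poly_ring.quot_mult[OF I yc p(1)] by (simp add: poly_ring_sel)
        then have "?y * p \<in> I" using poly_ring.quot_Idl_iff[OF I _ yp, of "{}"] I0 by simp
        then have "p \<in> I" by (rule y_regular[OF p(1)])
        then have "?\<pi> p \<in> Idl\<^bsub>?S\<^esub> (?\<pi> ` {})" using poly_ring.quot_Idl_iff[OF I _ p(1), of "{}"] I0 by simp
        then show ?thesis using 1 p(2) by simp
      next
        case 2
        have "?\<pi> (?z * p) \<in> Idl\<^bsub>?S\<^esub> (?\<pi> ` {?y})"
          using * 2 p poly_ring.quot_mult[OF I zc p(1)] by (simp add: poly_ring_sel)
        then have "?z * p \<in> J" using poly_ring.quot_Idl_iff[OF I _ zp, of "{?y}"] yc by (simp add: J_def)
        then have "p \<in> J" by (rule z_regular[OF p(1)])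
        then have "?\<pi> p \<in> Idl\<^bsub>?S\<^esub> (?\<pi> ` {?y})"
          using poly_ring.quot_Idl_iff[OF I _ p(1), of "{?y}"] yc by (simp add: J_def)
        then show ?thesis using 2 p(2) by simp
      qed
    qed
    show "Idl\<^bsub>?S\<^esub> (set [?\<pi> ?y, ?\<pi> ?z]) \<noteq> carrier ?S"
    proof
      assume "Idl\<^bsub>?S\<^esub> (set [?\<pi> ?y, ?\<pi> ?z]) = carrier ?S"
      then have "?\<pi> 1 \<in> Idl\<^bsub>?S\<^esub> (?\<pi> ` {?y, ?z})"
        unfolding poly_ring.carrier_quot using one_mem_poly_ring by auto
      then have "1 \<in> Idl\<^bsub>?R\<^esub> (I \<union> {?y, ?z})"
        using poly_ring.quot_Idl_iff[OF I _ one_mem_poly_ring, of "{?y, ?z}"] yc zc by simp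
      moreover have "Idl\<^bsub>?R\<^esub> (I \<union> {?y, ?z}) \<subseteq> irrelevant_ideal m"
        using Iirr yi zi by (intro poly_ring.genideal_minimal[OF irr]) auto
      ultimately have "1 \<in> (irrelevant_ideal m :: 'k mpoly set)" by blast
      then show False by (simp add: irrelevant_ideal_eq off_face_ideal_def monomial_ideal_def)
    qed
  qed
  moreover have "set [?\<pi> ?y, ?\<pi> ?z] \<subseteq> ?\<pi> ` irrelevant_ideal m" using yi zi by simp
  ultimately have "enat (length [?\<pi> ?y, ?\<pi> ?z]) \<le> depth ?S (?\<pi> ` irrelevant_ideal m)"
    unfolding depth_def by (intro SUP_upper) blast
  then show ?thesis by (simp add: m_def numeral_eq_enat numeral_2_eq_2)
qed

theorem theorem3p6:
  fixes n r :: nat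
    and I :: "((nat \<Rightarrow>\<^sub>0 nat) \<Rightarrow>\<^sub>0 'k::field) set"
  assumes "n \<ge> 5" and "r \<ge> 1"
    and "I = edge_ideal n (line_graph n)"
  shows "cohen_macaulay (n + r) (Inc_ideal n (n + r) I) \<longleftrightarrow> r = n - 4"
proof -
  define d where "d = r + 2"
  define m where "m = n + r"
  let ?G = "gap_ideal m d :: 'k mpoly set"
  have I: "Inc_ideal n (n + r) I = ?G"
    using assms(1,3) Inc_ideal_line_graph[of n r] by (simp add: d_def m_def)
  let ?dim = "krull_dim (poly_ring m Quot ?G)"
  let ?depth = "depth (poly_ring m Quot ?G) ((\<lambda>f. ?G +>\<^bsub>poly_ring m\<^esub> f) ` irrelevant_ideal m)"
  have CM: "cohen_macaulay (n + r) (Inc_ideal n (n + r) I) \<longleftrightarrow> ?depth = ?dim"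
    by (simp add: cohen_macaulay_def I m_def)
  have r: "r = n - 4 \<longleftrightarrow> m = 2 * d" using assms(1,2) by (auto simp: m_def d_def)
  have d: "2 \<le> d" "d < m" using assms(1) by (auto simp: m_def d_def)
  show ?thesis
    unfolding CM r
  proof
    assume m: "m = 2 * d"
    let ?F = "{d, m}"
    have F: "?F \<subseteq> {1..m}" "has_gaps d ?F" "card ?F = 2" using d m by (auto simp: has_gaps_def)
    \<comment> \<open>The vertex \<open>d\<close> excludes all others below \<open>2 d\<close>.\<close>
    have max: "\<not> has_gaps d (insert x ?F)" if "x \<in> {1..m}" "x \<notin> ?F" for x
      using that d m by (cases "x < d"; cases "x < m") (auto simp: has_gaps_def)
    have "?depth \<le> 2" using depth_gap_ideal_le[OF F(1,2) max] F(3) by (simp add: numeral_eq_enat)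
    moreover have "2 \<le> ?depth" unfolding m using d(1) by (intro depth_gap_ideal_ge_2) simp
    moreover have "2 \<le> ?dim" using krull_dim_gap_ideal_ge[OF F(1,2)] F(3) by (simp add: numeral_eq_enat)
    moreover have "?dim \<le> enat 2"
      by (rule krull_dim_gap_ideal_le) (use card_has_gaps_le_2 m in blast)
    ultimately show "?depth = ?dim" by (simp add: numeral_eq_enat)
  next
    assume eq: "?depth = ?dim"
    show "m = 2 * d"
    proof (rule ccontr)
      assume "m \<noteq> 2 * d"
      then obtain F G where F: "F \<subseteq> {1..m}" "has_gaps d F"
        "\<And>x. x \<in> {1..m} \<Longrightarrow> x \<notin> F \<Longrightarrow> \<not> has_gaps d (insert x F)"
        and G: "G \<subseteq> {1..m}" "has_gaps d G" and less: "card F < card G"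
        using two_maximal_sizes[OF d] by blast
      have "enat (card G) \<le> ?dim" by (rule krull_dim_gap_ideal_ge[OF G])
      also have "\<dots> = ?depth" using eq by simp
      also have "\<dots> \<le> enat (card F)" by (rule depth_gap_ideal_le[OF F])
      finally show False using less by simp
    qed
  qed
qed

end
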